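(* The strategy $\mathrm{ST}$ for applying the STAB tableau rules terminates on every regular schema; i.e. for every regular schema $\phi$ there is no infinite derivation constructed according to $\mathrm{ST}$ from the one-node tableau labeled $\{\phi\}$.
   Context: Schemata. Fix a countably infinite set of arithmetic variables and a countably infinite set $\mathcal P$ of propositional symbols. Linear arithmetic expressions are built from arithmetic variables and $0,s,+,-$, modulo the usual arithmetic laws. An indexed proposition is $p_a$ with $p\in\mathcal P$ and $a$ a linear arithmetic expression. Schemata form the smallest set such that: $\top,\bot$, $a<b$ ($a,b$ linear arithmetic expressions) and indexed propositions are schemata; schemata are closed under $\vee,\wedge,\neg$; if $\phi$ is a schema not containing $<$, $i$ is an arithmetic variable and $a,b$ are linear arithmetic expressions, then $\bigwedge_{i=a}^b\phi$ and $\bigvee_{i=a}^b\phi$ are schemata (iterations with bounds $a,b$ and length $b-a$). A variable is bound in $\phi$ if $\phi$ contains an iteration over it, and free (a parameter) if it occurs outside the scope of every iteration over it; no variable is both free and bound, and distinct iterations use distinct variables. $a\le b$, $a=b$, $a\neq b$ are the usual abbreviations. A literal is an indexed proposition or its negation. An arithmetic formula is a schema without iterations all of whose atoms are $\top$, $\bot$ or of the form $a<b$; arithmetic formulae are taken up to arithmetic equivalence, are interpreted over the integers, and parameters are assumed to take natural-number values. Schemata are assumed to be in negation normal form. A schema $\phi$ is regular if it has a unique parameter $n$ and: no iteration occurs inside the body of another iteration; every atom occurring in the body of an iteration over $i$ is of the form $p_{i+\gamma}$ with $\gamma\in\mathbb Z$; and there are $\alpha,\beta\in\mathbb Z$ such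 that all iterations in $\phi$ are of the form $\bigvee_{i=\alpha}^{n-\beta}\psi$ or $\bigwedge_{i=\alpha}^{n-\beta}\psi$. Tableaux. A tableau is a tree whose nodes $N$ are labeled by sets of schemata $\Phi_{\mathcal T}(N)$. Applying an extension rule with premises $P$ and conclusions $C_1|\dots|C_k$ to a leaf $N$ whose label contains $P$ adds $k$ children to $N$, labeled $C_\iota\cup(\Phi_{\mathcal T}(N)\setminus P)$. The extension rules are: ($\wedge$) from $\phi\wedge\psi$: the single conclusion $\{\phi,\psi\}$; ($\vee$) from $\phi\vee\psi$: conclusions $\{\phi\}\mid\{\psi\}$; (Iterated $\wedge$) from $\bigwedge_{i=a}^b\phi$: conclusions $\{\bigwedge_{i=a}^{b-1}\phi\wedge\phi[b/i],\ b\ge a\}\mid\{b<a\}$; (Iterated $\vee$) from $\bigvee_{i=a}^b\phi$: the single conclusion $\{\bigvee_{i=a}^{b-1}\phi\vee\phi[b/i],\ b\ge a\}$; (Closure) from $p_a,\neg p_b$: the single conclusion $\{p_a,\neg p_b,a\neq b\}$, applied only if $a\neq b$ does not already occur in the branch. A derivation is a sequence of tableaux, each obtained from the previous one by an extension rule. A leaf is closed if the set of arithmetic formulae in its label is unsatisfiable, or if it is blocked (defined below); closed leaves are not extended. The relation $\supseteq_s$. For a schema or set of schemata $\Phi$ and an expression $a$ occurring in it, define expressions $\min_\Phi(a),\max_\Phi(a)$ over the free variables of $\Phi$ by: $\min_\Phi(a)=\max_\Phi(a)=a$ if $a$ is an integer or a free variable; $\min_\Phi(b+c)=\min_\Phi(b)+\min_\Phi(c)$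 and likewise for $\max$; $\max_\Phi(-b)=-\min_\Phi(b)$, $\min_\Phi(-b)=-\max_\Phi(b)$; if $i$ is the variable of an iteration with bounds $a,b$, $\min_\Phi(i)=\min_\Phi(a)$ and $\max_\Phi(i)=\max_\Phi(b)$. $IC(\Phi)$ is the conjunction of the formulae $\min_\Phi(i)\le i\wedge i\le\max_\Phi(i)$ for all $i$ bound in $\Phi$. $\Phi_{\mathcal N}$ is the conjunction of the arithmetic formulae belonging to $\Phi$. A literal $p_a$ (resp. $\neg p_a$) is pure in $\Phi$ iff for every occurrence of a literal $\neg p_b$ (resp. $p_b$) in $\Phi$, $\Phi_{\mathcal N}\wedge IC(\Phi)\wedge a=b$ is unsatisfiable. A shift is a substitution mapping every variable $n$ to $n-\iota_n$ with $\iota_n\in\mathbb N$, where $\iota_n>0$ for at least one $n$. $\Phi\supseteq_s\Psi$ iff there is a shift $\sigma$ for the set of parameters of $\Phi$ and $\Psi$ such that for every $\psi\in\Psi$: either $\psi$ is an arithmetic formula and $\Phi_{\mathcal N}\models\psi\sigma$, or $\psi$ is a pure literal in $\Psi$, or $\psi\sigma\in\Phi$. Strategy ST. (i) The rules ($\wedge$), ($\vee$), the looping (blocking) test and (Closure) are applied as soon as possible on all leaves, with highest priority. (ii) The iteration rules are applied only on iterations of maximal length (for the natural partial order on arithmetic expressions, e.g. $n+\alpha\le n+\beta$ iff $\alpha\le\beta$). (iii) A leaf $N'$ is blocked when there is a node $N$ of the tableau with $\Phi_{\mathcal T}(N')\supseteq_s\Phi_{\mathcal T}(N)$. *)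

theory Defs
  imports Complex_Main "HOL-Library.Poly_Mapping" "HOL-Library.Product_Plus" "HOL-Library.Sublist"
begin

section \<open>Linear arithmetic expressions\<close>

text \<open>
  Arithmetic variables and propositional symbols are natural numbers. A linear arithmetic
  expression modulo the usual arithmetic laws is an integer constant together with a finitely
  supported family of integer coefficients; 0, addition and negation are the componentwise ones.
\<close>

type_synonym lexp = "int \<times> (nat \<Rightarrow>\<^sub>0 int)"

definition cst :: "int \<Rightarrow> lexp" where
  "cst c = (c, 0)"

definition var :: "nat \<Rightarrow> lexp" where
  "var x = (0, Poly_Mapping.single x 1)"

definition lscale :: "int \<Rightarrow> lexp \<Rightarrow> lexp" where
  "lscale k e = (k * fst e, Poly_Mapping.map (\<lambda>c. k * c) (snd e))"

definition coef :: "lexp \<Rightarrow> nat \<Rightarrow> int" where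
  "coef e x = Poly_Mapping.lookup (snd e) x"

definition lvars :: "lexp \<Rightarrow> nat set" where
  "lvars e = Poly_Mapping.keys (snd e)"

definition leval :: "(nat \<Rightarrow> int) \<Rightarrow> lexp \<Rightarrow> int" where
  "leval v e = fst e + (\<Sum>x\<in>lvars e. coef e x * v x)"

definition lsubst :: "(nat \<Rightarrow> lexp) \<Rightarrow> lexp \<Rightarrow> lexp" where
  "lsubst \<sigma> e = cst (fst e) + (\<Sum>x\<in>lvars e. lscale (coef e x) (\<sigma> x))"

text \<open>
  The pointwise order over the integers: one expression is below another iff they differ by a
  nonnegative constant.
\<close>

definition lle :: "lexp \<Rightarrow> lexp \<Rightarrow> bool" where
  "lle a b \<longleftrightarrow> (\<forall>v. leval v a \<le> leval v b)"


section \<open>Schemata\<close>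

datatype schema =
    Verum
  | Falsum
  | Less lexp lexp
  | Prop nat lexp
  | Neg schema
  | And schema schema
  | Or schema schema
  | BigAnd nat lexp lexp schema
  | BigOr nat lexp lexp schema

abbreviation Leq :: "lexp \<Rightarrow> lexp \<Rightarrow> schema" where
  "Leq a b \<equiv> Neg (Less b a)"

abbreviation Equ :: "lexp \<Rightarrow> lexp \<Rightarrow> schema" where
  "Equ a b \<equiv> And (Leq a b) (Leq b a)"

text \<open>The negation normal form of the negated equality:\<close>

abbreviation Neq :: "lexp \<Rightarrow> lexp \<Rightarrow> schema" where
  "Neq a b \<equiv> Or (Less a b) (Less b a)"

fun subschemata :: "schema \<Rightarrow> schema set" where
  "subschemata (Neg \<phi>) = insert (Neg \<phi>) (subschemata \<phi>)"
| "subschemata (And \<phi> \<psi>) = insert (And \<phi> \<psi>) (subschemata \<phi> \<union> subschemata \<psi>)"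
| "subschemata (Or \<phi> \<psi>) = insert (Or \<phi> \<psi>) (subschemata \<phi> \<union> subschemata \<psi>)"
| "subschemata (BigAnd i a b \<phi>) = insert (BigAnd i a b \<phi>) (subschemata \<phi>)"
| "subschemata (BigOr i a b \<phi>) = insert (BigOr i a b \<phi>) (subschemata \<phi>)"
| "subschemata \<phi> = {\<phi>}"

fun is_atom :: "schema \<Rightarrow> bool" where
  "is_atom Verum = True"
| "is_atom Falsum = True"
| "is_atom (Less a b) = True"
| "is_atom (Prop p a) = True"
| "is_atom _ = False"

definition atoms :: "schema \<Rightarrow> schema set" where
  "atoms \<phi> = {\<chi> \<in> subschemata \<phi>. is_atom \<chi>}"

definition iteration_over :: "schema \<Rightarrow> nat \<Rightarrow> lexp \<Rightarrow> lexp \<Rightarrow> schema \<Rightarrow> bool" where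
  "iteration_over \<chi> i a b \<psi> \<longleftrightarrow> \<chi> = BigAnd i a b \<psi> \<or> \<chi> = BigOr i a b \<psi>"

definition iterations :: "schema \<Rightarrow> schema set" where
  "iterations \<phi> = {\<chi> \<in> subschemata \<phi>. \<exists>i a b \<psi>. iteration_over \<chi> i a b \<psi>}"

definition bound_vars :: "schema \<Rightarrow> nat set" where
  "bound_vars \<phi> = {i. \<exists>\<chi>\<in>iterations \<phi>. \<exists>a b \<psi>. iteration_over \<chi> i a b \<psi>}"

text \<open>The bounds of an iteration are not in its scope.\<close>

fun free_vars :: "schema \<Rightarrow> nat set" where
  "free_vars Verum = {}"
| "free_vars Falsum = {}"
| "free_vars (Less a b) = lvars a \<union> lvars b"
| "free_vars (Prop p a) = lvars a"
| "free_vars (Neg \<phi>) = free_vars \<phi>"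
| "free_vars (And \<phi> \<psi>) = free_vars \<phi> \<union> free_vars \<psi>"
| "free_vars (Or \<phi> \<psi>) = free_vars \<phi> \<union> free_vars \<psi>"
| "free_vars (BigAnd i a b \<phi>) = lvars a \<union> lvars b \<union> (free_vars \<phi> - {i})"
| "free_vars (BigOr i a b \<phi>) = lvars a \<union> lvars b \<union> (free_vars \<phi> - {i})"

text \<open>
  Simultaneous substitution for the free occurrences. It does not rename bound variables; no
  capture arises as long as the substituted expressions contain no bound variable.
\<close>

fun subst :: "(nat \<Rightarrow> lexp) \<Rightarrow> schema \<Rightarrow> schema" where
  "subst \<sigma> Verum = Verum"
| "subst \<sigma> Falsum = Falsum"
| "subst \<sigma> (Less a b) = Less (lsubst \<sigma> a) (lsubst \<sigma> b)"
| "subst \<sigma> (Prop p a) = Prop p (lsubst \<sigma> a)"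
| "subst \<sigma> (Neg \<phi>) = Neg (subst \<sigma> \<phi>)"
| "subst \<sigma> (And \<phi> \<psi>) = And (subst \<sigma> \<phi>) (subst \<sigma> \<psi>)"
| "subst \<sigma> (Or \<phi> \<psi>) = Or (subst \<sigma> \<phi>) (subst \<sigma> \<psi>)"
| "subst \<sigma> (BigAnd i a b \<phi>) = BigAnd i (lsubst \<sigma> a) (lsubst \<sigma> b) (subst (\<sigma>(i := var i)) \<phi>)"
| "subst \<sigma> (BigOr i a b \<phi>) = BigOr i (lsubst \<sigma> a) (lsubst \<sigma> b) (subst (\<sigma>(i := var i)) \<phi>)"

definition inst :: "nat \<Rightarrow> lexp \<Rightarrow> schema \<Rightarrow> schema" where
  "inst i b \<phi> = subst (var(i := b)) \<phi>"

definition is_literal :: "schema \<Rightarrow> bool" where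
  "is_literal \<phi> \<longleftrightarrow> (\<exists>p a. \<phi> = Prop p a \<or> \<phi> = Neg (Prop p a))"

definition is_nnf :: "schema \<Rightarrow> bool" where
  "is_nnf \<phi> \<longleftrightarrow> (\<forall>\<chi>. Neg \<chi> \<in> subschemata \<phi> \<longrightarrow> is_atom \<chi>)"

text \<open>
  The datatype contains more than the schemata: the restriction on iteration bodies, the
  conventions on variables and negation normal form are imposed here.
\<close>

definition is_schema :: "schema \<Rightarrow> bool" where
  "is_schema \<phi> \<longleftrightarrow>
     (\<forall>\<chi>\<in>iterations \<phi>. \<forall>i a b \<psi> c d. iteration_over \<chi> i a b \<psi> \<longrightarrow> Less c d \<notin> subschemata \<psi>) \<and>
     free_vars \<phi> \<inter> bound_vars \<phi> = {} \<and>
     (\<forall>\<chi>\<in>iterations \<phi>. \<forall>\<chi>'\<in>iterations \<phi>. \<forall>i a b \<psi> a' b' \<psi>'.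
        iteration_over \<chi> i a b \<psi> \<and> iteration_over \<chi>' i a' b' \<psi>' \<longrightarrow> \<chi> = \<chi>') \<and>
     is_nnf \<phi>"

definition regular :: "schema \<Rightarrow> bool" where
  "regular \<phi> \<longleftrightarrow> is_schema \<phi> \<and>
     (\<exists>n. free_vars \<phi> = {n} \<and>
       (\<forall>\<chi>\<in>iterations \<phi>. \<forall>i a b \<psi>. iteration_over \<chi> i a b \<psi> \<longrightarrow>
          iterations \<psi> = {} \<and>
          (\<forall>A\<in>atoms \<psi>. \<exists>p \<gamma>. A = Prop p (var i + cst \<gamma>))) \<and>
       (\<exists>\<alpha> \<beta>. \<forall>\<chi>\<in>iterations \<phi>. \<exists>i \<psi>. iteration_over \<chi> i (cst \<alpha>) (var n - cst \<beta>) \<psi>))"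


section \<open>Arithmetic formulae\<close>

definition is_arith :: "schema \<Rightarrow> bool" where
  "is_arith \<phi> \<longleftrightarrow> iterations \<phi> = {} \<and>
     (\<forall>A\<in>atoms \<phi>. A = Verum \<or> A = Falsum \<or> (\<exists>a b. A = Less a b))"

text \<open>Truth over the integers; only meaningful for arithmetic formulae.\<close>

fun holds :: "(nat \<Rightarrow> int) \<Rightarrow> schema \<Rightarrow> bool" where
  "holds v Verum \<longleftrightarrow> True"
| "holds v (Less a b) \<longleftrightarrow> leval v a < leval v b"
| "holds v (Neg \<phi>) \<longleftrightarrow> \<not> holds v \<phi>"
| "holds v (And \<phi> \<psi>) \<longleftrightarrow> holds v \<phi> \<and> holds v \<psi>"
| "holds v (Or \<phi> \<psi>) \<longleftrightarrow> holds v \<phi> \<or> holds v \<psi>"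
| "holds v _ \<longleftrightarrow> False"

text \<open>The set \<open>V\<close> collects the parameters, which take natural-number values.\<close>

definition arith_sat :: "nat set \<Rightarrow> schema set \<Rightarrow> bool" where
  "arith_sat V \<Gamma> \<longleftrightarrow> (\<exists>v. (\<forall>x\<in>V. 0 \<le> v x) \<and> (\<forall>\<chi>\<in>\<Gamma>. holds v \<chi>))"

definition arith_entails :: "nat set \<Rightarrow> schema set \<Rightarrow> schema \<Rightarrow> bool" where
  "arith_entails V \<Gamma> \<psi> \<longleftrightarrow>
     (\<forall>v. (\<forall>x\<in>V. 0 \<le> v x) \<and> (\<forall>\<chi>\<in>\<Gamma>. holds v \<chi>) \<longrightarrow> holds v \<psi>)"

definition arith_equiv :: "schema \<Rightarrow> schema \<Rightarrow> bool" where
  "arith_equiv \<chi> \<psi> \<longleftrightarrow> is_arith \<chi> \<and> is_arith \<psi> \<and>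
     (\<forall>v. (\<forall>x\<in>free_vars \<chi> \<union> free_vars \<psi>. 0 \<le> v x) \<longrightarrow> (holds v \<chi> \<longleftrightarrow> holds v \<psi>))"

text \<open>Equality of schemata, arithmetic formulae being taken up to arithmetic equivalence:\<close>

inductive same_schema :: "schema \<Rightarrow> schema \<Rightarrow> bool" where
  same_arith: "arith_equiv \<phi> \<psi> \<Longrightarrow> same_schema \<phi> \<psi>"
| same_prop: "same_schema (Prop p a) (Prop p a)"
| same_neg: "same_schema \<phi> \<phi>' \<Longrightarrow> same_schema (Neg \<phi>) (Neg \<phi>')"
| same_and: "same_schema \<phi> \<phi>' \<Longrightarrow> same_schema \<psi> \<psi>' \<Longrightarrow> same_schema (And \<phi> \<psi>) (And \<phi>' \<psi>')"
| same_or: "same_schema \<phi> \<phi>' \<Longrightarrow> same_schema \<psi> \<psi>' \<Longrightarrow> same_schema (Or \<phi> \<psi>) (Or \<phi>' \<psi>')"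
| same_bigand: "same_schema \<phi> \<phi>' \<Longrightarrow> same_schema (BigAnd i a b \<phi>) (BigAnd i a b \<phi>')"
| same_bigor: "same_schema \<phi> \<phi>' \<Longrightarrow> same_schema (BigOr i a b \<phi>) (BigOr i a b \<phi>')"


section \<open>Pure literals\<close>

definition set_free_vars :: "schema set \<Rightarrow> nat set" where
  "set_free_vars \<Phi> = (\<Union>\<phi>\<in>\<Phi>. free_vars \<phi>)"

definition set_bound_vars :: "schema set \<Rightarrow> nat set" where
  "set_bound_vars \<Phi> = (\<Union>\<phi>\<in>\<Phi>. bound_vars \<phi>)"

definition set_iterations :: "schema set \<Rightarrow> schema set" where
  "set_iterations \<Phi> = (\<Union>\<phi>\<in>\<Phi>. iterations \<phi>)"

text \<open>
  Minimum and maximum of an expression in normal form, given those of its variables: both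
  commute with sums, and a negative coefficient exchanges them.
\<close>

definition lmin :: "(nat \<Rightarrow> lexp) \<Rightarrow> (nat \<Rightarrow> lexp) \<Rightarrow> lexp \<Rightarrow> lexp" where
  "lmin m M e =
     cst (fst e) + (\<Sum>x\<in>lvars e. lscale (coef e x) (if 0 < coef e x then m x else M x))"

definition lmax :: "(nat \<Rightarrow> lexp) \<Rightarrow> (nat \<Rightarrow> lexp) \<Rightarrow> lexp \<Rightarrow> lexp" where
  "lmax m M e =
     cst (fst e) + (\<Sum>x\<in>lvars e. lscale (coef e x) (if 0 < coef e x then M x else m x))"

text \<open>
  \<open>var_min_max \<Phi> x d e\<close>: the minimum of the variable \<open>x\<close> in \<open>\<Phi>\<close> is \<open>d\<close> and its maximum
  is \<open>e\<close>. A relation, since the recursion through the bounds of the iterations need not be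
  well-founded on arbitrary elements of the datatype; distinct iterations having distinct
  variables, it is functional on sets of schemata.
\<close>

inductive var_min_max :: "schema set \<Rightarrow> nat \<Rightarrow> lexp \<Rightarrow> lexp \<Rightarrow> bool" for \<Phi> where
  free: "x \<notin> set_bound_vars \<Phi> \<Longrightarrow> var_min_max \<Phi> x (var x) (var x)"
| bound: "\<chi> \<in> set_iterations \<Phi> \<Longrightarrow> iteration_over \<chi> x a b \<psi> \<Longrightarrow>
    (\<And>y. y \<in> lvars a \<union> lvars b \<Longrightarrow> var_min_max \<Phi> y (m y) (M y)) \<Longrightarrow>
    var_min_max \<Phi> x (lmin m M a) (lmax m M b)"

definition IC :: "schema set \<Rightarrow> schema set" where
  "IC \<Phi> = {And (Leq d (var i)) (Leq (var i) e) | i d e.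
     i \<in> set_bound_vars \<Phi> \<and> var_min_max \<Phi> i d e}"

definition arith_part :: "schema set \<Rightarrow> schema set" where
  "arith_part \<Phi> = {\<phi> \<in> \<Phi>. is_arith \<phi>}"

text \<open>The occurrences of literals in a schema in negation normal form:\<close>

fun literals :: "schema \<Rightarrow> schema set" where
  "literals (Prop p a) = {Prop p a}"
| "literals (Neg (Prop p a)) = {Neg (Prop p a)}"
| "literals (And \<phi> \<psi>) = literals \<phi> \<union> literals \<psi>"
| "literals (Or \<phi> \<psi>) = literals \<phi> \<union> literals \<psi>"
| "literals (BigAnd i a b \<phi>) = literals \<phi>"
| "literals (BigOr i a b \<phi>) = literals \<phi>"
| "literals _ = {}"

definition excluded_equality :: "schema set \<Rightarrow> lexp \<Rightarrow> lexp \<Rightarrow> bool" where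
  "excluded_equality \<Phi> a b \<longleftrightarrow>
     \<not> arith_sat (set_free_vars \<Phi>) (arith_part \<Phi> \<union> IC \<Phi> \<union> {Equ a b})"

definition pure_literal :: "schema set \<Rightarrow> schema \<Rightarrow> bool" where
  "pure_literal \<Phi> l \<longleftrightarrow>
     (\<exists>p a. l = Prop p a \<and>
        (\<forall>\<phi>\<in>\<Phi>. \<forall>b. Neg (Prop p b) \<in> literals \<phi> \<longrightarrow> excluded_equality \<Phi> a b)) \<or>
     (\<exists>p a. l = Neg (Prop p a) \<and>
        (\<forall>\<phi>\<in>\<Phi>. \<forall>b. Prop p b \<in> literals \<phi> \<longrightarrow> excluded_equality \<Phi> a b))"


section \<open>The looping relation\<close>

text \<open>A shift for the set \<open>V\<close> of variables, given by the decrements \<open>\<iota>\<close>:\<close>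

definition is_shift :: "nat set \<Rightarrow> (nat \<Rightarrow> nat) \<Rightarrow> bool" where
  "is_shift V \<iota> \<longleftrightarrow> (\<forall>x. x \<notin> V \<longrightarrow> \<iota> x = 0) \<and> (\<exists>x\<in>V. 0 < \<iota> x)"

definition shift :: "(nat \<Rightarrow> nat) \<Rightarrow> schema \<Rightarrow> schema" where
  "shift \<iota> = subst (\<lambda>x. var x - cst (int (\<iota> x)))"

definition subsumes_shifted :: "schema set \<Rightarrow> schema set \<Rightarrow> bool" (infix \<open>\<supseteq>\<^sub>s\<close> 50) where
  "\<Phi> \<supseteq>\<^sub>s \<Psi> \<longleftrightarrow> (\<exists>\<iota>. is_shift (set_free_vars \<Phi> \<union> set_free_vars \<Psi>) \<iota> \<and>
     (\<forall>\<psi>\<in>\<Psi>.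
        is_arith \<psi> \<and>
          arith_entails (set_free_vars \<Phi> \<union> set_free_vars \<Psi>) (arith_part \<Phi>) (shift \<iota> \<psi>) \<or>
        is_literal \<psi> \<and> pure_literal \<Psi> \<psi> \<or>
        (\<exists>\<phi>\<in>\<Phi>. same_schema \<phi> (shift \<iota> \<psi>))))"


section \<open>Tableaux\<close>

text \<open>
  A node is the list of child indices leading to it from the root; a tableau maps its nodes to
  their labels.
\<close>

type_synonym tableau = "nat list \<Rightarrow> schema set option"

definition initial :: "schema \<Rightarrow> tableau" where
  "initial \<phi> = [[] \<mapsto> {\<phi>}]"

definition label :: "tableau \<Rightarrow> nat list \<Rightarrow> schema set" where
  "label T N = the (T N)"

definition leaf :: "tableau \<Rightarrow> nat list \<Rightarrow> bool" where
  "leaf T N \<longleftrightarrow> N \<in> dom T \<and> (\<forall>k. N @ [k] \<notin> dom T)"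

definition branch :: "tableau \<Rightarrow> nat list \<Rightarrow> schema set" where
  "branch T N = (\<Union>M\<in>{M. prefix M N}. label T M)"

definition extend :: "tableau \<Rightarrow> nat list \<Rightarrow> schema set \<Rightarrow> schema set list \<Rightarrow> tableau" where
  "extend T N P Cs = (\<lambda>M. if \<exists>k<length Cs. M = N @ [k]
     then Some (Cs ! last M \<union> (label T N - P)) else T M)"

datatype rule_name = RAnd | ROr | RIterAnd | RIterOr | RClosure

text \<open>
  \<open>rule B r P Cs\<close>: the rule \<open>r\<close>, on a branch in which the schemata in \<open>B\<close> occur, has the
  premises \<open>P\<close> and the conclusions \<open>Cs\<close>.
\<close>

inductive rule :: "schema set \<Rightarrow> rule_name \<Rightarrow> schema set \<Rightarrow> schema set list \<Rightarrow> bool" for B where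
  rule_and: "rule B RAnd {And \<phi> \<psi>} [{\<phi>, \<psi>}]"
| rule_or: "rule B ROr {Or \<phi> \<psi>} [{\<phi>}, {\<psi>}]"
| rule_iter_and: "rule B RIterAnd {BigAnd i a b \<phi>}
    [{And (BigAnd i a (b - cst 1) \<phi>) (inst i b \<phi>), Leq a b}, {Less b a}]"
| rule_iter_or: "rule B RIterOr {BigOr i a b \<phi>}
    [{Or (BigOr i a (b - cst 1) \<phi>) (inst i b \<phi>), Leq a b}]"
| rule_closure: "\<not> (\<exists>\<chi>\<in>B. same_schema \<chi> (Neq a b)) \<Longrightarrow>
    rule B RClosure {Prop p a, Neg (Prop p b)} [{Prop p a, Neg (Prop p b), Neq a b}]"

definition blocked :: "tableau \<Rightarrow> nat list \<Rightarrow> bool" where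
  "blocked T N' \<longleftrightarrow> (\<exists>N\<in>dom T. label T N' \<supseteq>\<^sub>s label T N)"

definition closed_leaf :: "tableau \<Rightarrow> nat list \<Rightarrow> bool" where
  "closed_leaf T N \<longleftrightarrow> leaf T N \<and>
     (\<not> arith_sat (set_free_vars (label T N)) (arith_part (label T N)) \<or> blocked T N)"

definition applicable ::
    "rule_name \<Rightarrow> tableau \<Rightarrow> nat list \<Rightarrow> schema set \<Rightarrow> schema set list \<Rightarrow> bool" where
  "applicable r T N P Cs \<longleftrightarrow>
     leaf T N \<and> \<not> closed_leaf T N \<and> P \<subseteq> label T N \<and> rule (branch T N) r P Cs"


section \<open>The strategy ST\<close>

definition max_length_in :: "schema set \<Rightarrow> schema \<Rightarrow> bool" where
  "max_length_in \<Phi> \<chi> \<longleftrightarrow> (\<exists>i a b \<psi>. iteration_over \<chi> i a b \<psi> \<and>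
     (\<forall>\<chi>'\<in>set_iterations \<Phi>. \<forall>i' a' b' \<psi>'. iteration_over \<chi>' i' a' b' \<psi>' \<longrightarrow>
        \<not> (lle (b - a) (b' - a') \<and> b - a \<noteq> b' - a')))"

text \<open>
  The blocking test has the highest priority too: \<open>blocked\<close> is evaluated in the current
  tableau before each extension.
\<close>

definition ST_step :: "tableau \<Rightarrow> tableau \<Rightarrow> bool" where
  "ST_step T T' \<longleftrightarrow> (\<exists>r N P Cs. applicable r T N P Cs \<and> T' = extend T N P Cs \<and>
     (r \<in> {RIterAnd, RIterOr} \<longrightarrow>
        (\<forall>\<chi>\<in>P. max_length_in (label T N) \<chi>) \<and>
        \<not> (\<exists>r' N' P' Cs'. r' \<in> {RAnd, ROr, RClosure} \<and> applicable r' T N' P' Cs')))"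

definition ST_infinite_derivation :: "(nat \<Rightarrow> tableau) \<Rightarrow> schema \<Rightarrow> bool" where
  "ST_infinite_derivation D \<phi> \<longleftrightarrow> D 0 = initial \<phi> \<and> (\<forall>k. ST_step (D k) (D (Suc k)))"

end

theory Submission
  imports Defs
begin

text \<open>
  By Koenig's lemma an infinite derivation has an infinite branch, none of whose labels subsumes
  an earlier one after a shift. On such a branch the iterations are unrolled with upper bounds
  \<open>n - \<beta> - k\<close> for unboundedly many \<open>k\<close>, since only finitely many closure steps are possible while
  \<open>k\<close> is bounded. As every unrolling adds \<open>\<alpha> \<le> n - \<beta> - k\<close>, any upper bound on \<open>n\<close> would
  eventually close the branch. So, when a label is saturated, its constraints amount to \<open>n \<ge> B\<close>
  with \<open>B - k\<close> bounded, and for large \<open>k\<close> a literal \<open>p\<^sub>a\<close> is pure unless \<open>a\<close> is a constant or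
  \<open>a = n - k + e\<close> with \<open>e\<close> in a fixed finite window: the literals met by the remaining iterations
  lie between constants and \<open>n - k\<close>, and closure has separated the literals of the label.
  Relatively to \<open>k\<close> only finitely many configurations remain; two labels with the same
  configuration differ by a shift of \<open>n\<close>, and the later one is blocked.
\<close>

section \<open>Infinite branches\<close>

definition ST_saturated :: "schema set \<Rightarrow> schema set \<Rightarrow> bool" where
  "ST_saturated B \<Phi> \<longleftrightarrow>
     (\<forall>r P Cs. r \<in> {RAnd, ROr, RClosure} \<and> P \<subseteq> \<Phi> \<longrightarrow> \<not> rule B r P Cs)"

definition ST_branch_step :: "schema set \<Rightarrow> schema set \<Rightarrow> schema set \<Rightarrow> bool" where
  "ST_branch_step B \<Phi> \<Psi> \<longleftrightarrow> (\<exists>r P Cs C. rule B r P Cs \<and> P \<subseteq> \<Phi> \<and> C \<in> set Cs \<and> \<Psi> = C \<union> (\<Phi> - P) \<and>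
     (r \<in> {RIterAnd, RIterOr} \<longrightarrow> (\<forall>\<chi>\<in>P. max_length_in \<Phi> \<chi>) \<and> ST_saturated B \<Phi>))"

text \<open>What the strategy guarantees along a single branch. Non-blocking is recorded only
  against ancestors, although the strategy tests all nodes of the tableau: the loop will be found on
  the branch itself.\<close>

definition ST_branch :: "(nat \<Rightarrow> schema set) \<Rightarrow> bool" where
  "ST_branch L \<longleftrightarrow> (\<forall>t. arith_sat (set_free_vars (L t)) (arith_part (L t)) \<and>
     (\<forall>s\<le>t. \<not> L t \<supseteq>\<^sub>s L s) \<and> ST_branch_step (\<Union>s\<le>t. L s) (L t) (L (Suc t)))"

lemma rule_conclusions: "rule B r P Cs \<Longrightarrow> Cs \<noteq> [] \<and> length Cs \<le> 2"
  by (induction rule: rule.induct) auto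

text \<open>Koenig's lemma: nodes keep their labels, every step adds a node, and no rule has more
  than two conclusions, so the union of the tableaux is an infinite, finitely branching
  tree.\<close>

lemma ST_infinite_derivation_branch:
  assumes "ST_infinite_derivation D \<phi>"
  obtains L where "L 0 = {\<phi>}" and "ST_branch L"
proof -
  have D0: "D 0 = initial \<phi>" and step: "ST_step (D k) (D (Suc k))" for k
    using assms by (auto simp: ST_infinite_derivation_def)
  have D0_dom: "dom (D 0) = {[]}"
    by (simp add: D0 initial_def)
  have persist_Suc: "D (Suc k) M = D k M" if "M \<in> dom (D k)" for k M
  proof -
    obtain r N P Cs where "leaf (D k) N" "D (Suc k) = extend (D k) N P Cs"
      using step[of k] unfolding ST_step_def applicable_def by blast
    then show ?thesis using that by (auto simp: leaf_def extend_def)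
  qed
  have persist: "D l M = D k M" if "k \<le> l" "M \<in> dom (D k)" for k l M
    using that(1)
  proof (induction l rule: dec_induct)
    case (step m)
    then show ?case using persist_Suc[of M m] that(2) by (auto simp: dom_def)
  qed simp
  have dom_mono: "dom (D k) \<subseteq> dom (D l)" if "k \<le> l" for k l
    using persist[OF that] by (auto simp: dom_def)
  define tree where "tree = (\<Union>k. dom (D k))"
  define lab where "lab N = label (D (LEAST k. N \<in> dom (D k))) N" for N
  have lab: "label (D k) N = lab N" if "N \<in> dom (D k)" for k N
  proof -
    have "N \<in> dom (D (LEAST k. N \<in> dom (D k)))" "(LEAST k. N \<in> dom (D k)) \<le> k"
      using LeastI[of "\<lambda>k. N \<in> dom (D k)", OF that] that by (auto intro: Least_le)
    then show ?thesis
      using persist unfolding lab_def label_def by metis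
  qed
  \<comment> \<open>A child is traced back to the step that created it: at that moment its parent
    was an open leaf, so all conditions of the strategy are available there.\<close>
  have child: "\<exists>k r P Cs. applicable r (D k) N P Cs \<and> D (Suc k) = extend (D k) N P Cs \<and> x < length Cs \<and>
      (r \<in> {RIterAnd, RIterOr} \<longrightarrow> (\<forall>\<chi>\<in>P. max_length_in (label (D k) N) \<chi>) \<and>
        \<not> (\<exists>r' N' P' Cs'. r' \<in> {RAnd, ROr, RClosure} \<and> applicable r' (D k) N' P' Cs'))"
    if Nx: "N @ [x] \<in> tree" for N x
  proof -
    obtain k where k: "N @ [x] \<in> dom (D k)" "\<And>l. l < k \<Longrightarrow> N @ [x] \<notin> dom (D l)"
      using Nx exists_least_iff[of "\<lambda>k. N @ [x] \<in> dom (D k)"] unfolding tree_def by blast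
    with D0_dom obtain l where l: "k = Suc l" by (cases k) auto
    with k have new: "N @ [x] \<in> dom (D (Suc l))" "N @ [x] \<notin> dom (D l)" by auto
    obtain r N' P Cs where app: "applicable r (D l) N' P Cs" "D (Suc l) = extend (D l) N' P Cs"
      "r \<in> {RIterAnd, RIterOr} \<longrightarrow> (\<forall>\<chi>\<in>P. max_length_in (label (D l) N') \<chi>) \<and>
        \<not> (\<exists>r' N' P' Cs'. r' \<in> {RAnd, ROr, RClosure} \<and> applicable r' (D l) N' P' Cs')"
      using step[of l] unfolding ST_step_def by blast
    have "N' = N \<and> x < length Cs"
      using new unfolding app(2) extend_def by (auto split: if_splits)
    with app show ?thesis by blast
  qed
  have tree_prefix: "M \<in> tree" if "N \<in> tree" "prefix M N" for M N
    using that
  proof (induction N rule: rev_induct)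
    case (snoc x N)
    then have "M = N @ [x] \<or> prefix M N" by auto
    moreover have "N \<in> tree"
      using child[OF snoc.prems(1)] by (auto simp: applicable_def leaf_def tree_def)
    ultimately show ?case using snoc by auto
  qed simp
  have new: "\<exists>M. M \<in> dom (D (Suc k)) \<and> M \<notin> dom (D k)" for k
  proof -
    obtain r N P Cs where "applicable r (D k) N P Cs" "D (Suc k) = extend (D k) N P Cs"
      using step[of k] unfolding ST_step_def by blast
    moreover from this rule_conclusions have "0 < length Cs" unfolding applicable_def by blast
    ultimately have "N @ [0] \<in> dom (D (Suc k))" "N @ [0] \<notin> dom (D k)"
      by (auto simp: applicable_def leaf_def extend_def)
    then show ?thesis by blast
  qed
  have "infinite tree"
  proof
    assume fin: "finite tree"
    then have fin_dom: "finite (dom (D k))" for k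
      by (rule rev_finite_subset) (auto simp: tree_def)
    have "k \<le> card (dom (D k))" for k
    proof (induction k)
      case (Suc k)
      have "dom (D k) \<subset> dom (D (Suc k))"
        using dom_mono[of k "Suc k"] new[of k] by auto
      then have "card (dom (D k)) < card (dom (D (Suc k)))"
        using fin_dom by (simp add: psubset_card_mono)
      with Suc show ?case by simp
    qed simp
    moreover have "card (dom (D k)) \<le> card tree" for k
      using fin by (intro card_mono) (auto simp: tree_def)
    ultimately show False
      by (metis Suc_n_not_le_n order_trans)
  qed
  define big where "big N \<longleftrightarrow> infinite {M \<in> tree. prefix N M}" for N
  have big_Nil: "big []" using \<open>infinite tree\<close> by (simp add: big_def)
  have big_tree: "N \<in> tree" if "big N" for N
  proof -
    from that have "{M \<in> tree. prefix N M} \<noteq> {}" unfolding big_def by force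
    then show ?thesis using tree_prefix by auto
  qed
  \<comment> \<open>Every proper descendant passes through child 0 or child 1, so one of these two
    must again have infinitely many descendants.\<close>
  have big_snoc: "\<exists>x. big (N @ [x])" if "big N" for N
  proof (rule ccontr)
    assume "\<not> ?thesis"
    then have "finite (insert N (\<Union>x<2. {M \<in> tree. prefix (N @ [x]) M}))"
      by (auto simp: big_def)
    moreover have "{M \<in> tree. prefix N M} \<subseteq> insert N (\<Union>x<2. {M \<in> tree. prefix (N @ [x]) M})"
    proof
      fix M assume M: "M \<in> {M \<in> tree. prefix N M}"
      show "M \<in> insert N (\<Union>x<2. {M \<in> tree. prefix (N @ [x]) M})"
      proof (cases "M = N")
        case False
        with M obtain x ys where x: "M = N @ x # ys"
          by (metis (no_types, lifting) append_Nil2 list.exhaust mem_Collect_eq prefixE)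
        then have pre: "prefix (N @ [x]) M" by simp
        with M have "N @ [x] \<in> tree" using tree_prefix by blast
        then obtain k r P Cs where "applicable r (D k) N P Cs" and len: "x < length Cs"
          using child by blast
        then have "length Cs \<le> 2" using rule_conclusions unfolding applicable_def by blast
        with len have "x < 2" by simp
        with pre M show ?thesis by blast
      qed simp
    qed
    ultimately show False using that finite_subset unfolding big_def by blast
  qed
  define f where "f = rec_nat [] (\<lambda>_ N. N @ [SOME x. big (N @ [x])])"
  have f0: "f 0 = []" and fSuc: "f (Suc t) = f t @ [SOME x. big (f t @ [x])]" for t
    by (simp_all add: f_def)
  have big_f: "big (f t)" for t
  proof (induction t)
    case (Suc t)
    then show ?case unfolding fSuc by (rule someI_ex[OF big_snoc])
  qed (simp add: f0 big_Nil)
  have prefixes_f: "{M. prefix M (f t)} = f ` {..t}" for t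
  proof (induction t)
    case (Suc t)
    have "{M. prefix M (f (Suc t))} = insert (f (Suc t)) {M. prefix M (f t)}"
      unfolding fSuc by auto
    then show ?case by (simp add: Suc atMost_Suc)
  qed (simp add: f0)
  define L where "L t = lab (f t)" for t
  have "L 0 = {\<phi>}"
  proof -
    have "lab [] = label (D 0) []" by (intro lab[symmetric]) (simp add: D0_dom)
    then show ?thesis by (simp add: L_def f0 D0 label_def initial_def)
  qed
  moreover have "ST_branch L"
    unfolding ST_branch_def
  proof (intro allI)
    fix t
    obtain x where x: "f (Suc t) = f t @ [x]" using fSuc by blast
    have "f t @ [x] \<in> tree" using big_tree[OF big_f, of "Suc t"] x by simp
    from child[OF this] obtain k r P Cs where
      app: "applicable r (D k) (f t) P Cs" and D: "D (Suc k) = extend (D k) (f t) P Cs"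
      and len: "x < length Cs" and
      iter: "r \<in> {RIterAnd, RIterOr} \<longrightarrow> (\<forall>\<chi>\<in>P. max_length_in (label (D k) (f t)) \<chi>) \<and>
        \<not> (\<exists>r' N' P' Cs'. r' \<in> {RAnd, ROr, RClosure} \<and> applicable r' (D k) N' P' Cs')"
      by blast
    have lf: "leaf (D k) (f t)" and ncl: "\<not> closed_leaf (D k) (f t)"
      and P: "P \<subseteq> label (D k) (f t)" and rl: "rule (branch (D k) (f t)) r P Cs"
      using app unfolding applicable_def by auto
    have ft: "f s \<in> dom (D k)" if "s \<le> t" for s
    proof -
      \<comment> \<open>Domains are closed under prefixes, so all ancestors of \<open>f t\<close>
        are present when it is extended.\<close>
      have *: "M \<in> dom (D k)" if "prefix M N" "N \<in> dom (D k)" for M N k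
        using that
      proof (induction k arbitrary: M N)
        case 0
        then show ?case by (simp add: D0_dom)
      next
        case (Suc k)
        obtain r N' P Cs where a: "applicable r (D k) N' P Cs" "D (Suc k) = extend (D k) N' P Cs"
          using step[of k] unfolding ST_step_def by blast
        show ?case
        proof (cases "N \<in> dom (D k)")
          case True
          then have "M \<in> dom (D k)" by (rule Suc.IH[OF Suc.prems(1)])
          then show ?thesis using dom_mono[of k "Suc k"] by auto
        next
          case False
          with Suc.prems(2) obtain j where j: "N = N' @ [j]"
            unfolding a(2) extend_def by (auto split: if_splits)
          with Suc.prems(1) have "M = N \<or> prefix M N'" by auto
          moreover have "N' \<in> dom (D k)" using a(1) by (auto simp: applicable_def leaf_def)
          ultimately have "M = N \<or> M \<in> dom (D k)" using Suc.IH by blast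
          then show ?thesis using Suc.prems(2) dom_mono[of k "Suc k"] by auto
        qed
      qed
      have "prefix (f s) (f t)" using prefixes_f[of t] that by blast
      moreover have "f t \<in> dom (D k)" using lf by (simp add: leaf_def)
      ultimately show ?thesis by (rule *)
    qed
    have Ls: "label (D k) (f s) = L s" if "s \<le> t" for s
      using lab[OF ft[OF that]] by (simp add: L_def)
    have br: "branch (D k) (f t) = (\<Union>s\<le>t. L s)"
      unfolding branch_def prefixes_f using Ls by auto
    have "L (Suc t) = label (D (Suc k)) (f (Suc t))"
      unfolding L_def by (rule lab[symmetric]) (use x len D in \<open>auto simp: extend_def\<close>)
    also have "\<dots> = Cs ! x \<union> (L t - P)"
      using len x Ls[of t] by (auto simp: D label_def extend_def)
    finally have LS: "L (Suc t) = Cs ! x \<union> (L t - P)" .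
    have "arith_sat (set_free_vars (L t)) (arith_part (L t))" and nb: "\<not> blocked (D k) (f t)"
      using lf ncl Ls[of t] unfolding closed_leaf_def by auto
    moreover have "\<not> L t \<supseteq>\<^sub>s L s" if "s \<le> t" for s
      using nb ft[OF that] Ls[OF that] Ls[of t] unfolding blocked_def by (metis order_refl)
    moreover have "ST_branch_step (\<Union>s\<le>t. L s) (L t) (L (Suc t))"
      unfolding ST_branch_step_def
    proof (intro exI conjI)
      show "rule (\<Union>s\<le>t. L s) r P Cs" using rl br by simp
      show "P \<subseteq> L t" using P Ls[of t] by simp
      show "Cs ! x \<in> set Cs" using len by simp
      show "L (Suc t) = Cs ! x \<union> (L t - P)" by (rule LS)
      show "r \<in> {RIterAnd, RIterOr} \<longrightarrow> (\<forall>\<chi>\<in>P. max_length_in (L t) \<chi>) \<and> ST_saturated (\<Union>s\<le>t. L s) (L t)"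
      proof
        assume "r \<in> {RIterAnd, RIterOr}"
        then have it: "\<forall>\<chi>\<in>P. max_length_in (L t) \<chi>"
          and na: "\<not> applicable r' (D k) (f t) P' Cs'" if "r' \<in> {RAnd, ROr, RClosure}" for r' P' Cs'
          using iter Ls[of t] that by auto
        have "\<not> rule (\<Union>s\<le>t. L s) r' P' Cs'" if "r' \<in> {RAnd, ROr, RClosure}" "P' \<subseteq> L t" for r' P' Cs'
          using na[OF that(1), of P' Cs'] that(2) lf ncl Ls[of t] br unfolding applicable_def by simp
        with it show "(\<forall>\<chi>\<in>P. max_length_in (L t) \<chi>) \<and> ST_saturated (\<Union>s\<le>t. L s) (L t)"
          unfolding ST_saturated_def by blast
      qed
    qed
    ultimately show "arith_sat (set_free_vars (L t)) (arith_part (L t)) \<and>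
     (\<forall>s\<le>t. \<not> L t \<supseteq>\<^sub>s L s) \<and> ST_branch_step (\<Union>s\<le>t. L s) (L t) (L (Suc t))" by blast
  qed
  ultimately show ?thesis by (rule that)
qed

section \<open>Expressions and schemata\<close>

lemma lvars_eq: "lvars e = {x. coef e x \<noteq> 0}"
  by (auto simp: lvars_def coef_def in_keys_iff)

lemma finite_lvars [simp]: "finite (lvars e)"
  by (simp add: lvars_def)

lemma coef_simps [simp]:
  "coef (a + b) x = coef a x + coef b x"
  "coef (a - b) x = coef a x - coef b x"
  "coef (cst c) x = 0"
  "coef (var y) x = (if x = y then 1 else 0)"
  "coef (lscale c a) x = c * coef a x"
  by (auto simp: coef_def cst_def var_def lscale_def lookup_add lookup_minus lookup_single
      Poly_Mapping.map.rep_eq when_def)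

lemma fst_simps [simp]: "fst (cst c) = c" "fst (var x) = 0" "fst (lscale c a) = c * fst a"
  by (simp_all add: cst_def var_def lscale_def)

lemma lexp_eqI: "fst a = fst b \<Longrightarrow> (\<And>x. coef a x = coef b x) \<Longrightarrow> a = b"
  by (auto simp: prod_eq_iff coef_def intro: poly_mapping_eqI)

lemma leval_superset:
  assumes "finite A" "lvars e \<subseteq> A"
  shows "leval v e = fst e + (\<Sum>x\<in>A. coef e x * v x)"
  unfolding leval_def using assms by (simp add: lvars_eq, intro sum.mono_neutral_left) auto

lemma leval_add [simp]: "leval v (a + b) = leval v a + leval v b"
proof -
  have fin: "finite (lvars a \<union> lvars b)" by simp
  have "lvars (a + b) \<subseteq> lvars a \<union> lvars b" by (auto simp: lvars_eq)
  from leval_superset[OF fin this] leval_superset[OF fin, of a] leval_superset[OF fin, of b]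
  show ?thesis by (simp add: sum.distrib algebra_simps)
qed

lemma leval_lscale [simp]: "leval v (lscale c a) = c * leval v a"
proof -
  have "lvars (lscale c a) \<subseteq> lvars a" by (auto simp: lvars_eq)
  from leval_superset[OF _ this] leval_superset[of "lvars a" a]
  show ?thesis by (simp add: sum_distrib_left algebra_simps)
qed

lemma leval_diff [simp]: "leval v (a - b) = leval v a - leval v b"
  using leval_add[of v "a - b" b] by simp

lemma leval_cst [simp]: "leval v (cst c) = c"
  by (simp add: leval_def lvars_eq)

lemma leval_var [simp]: "leval v (var x) = v x"
proof -
  have "lvars (var x) = {x}" by (auto simp: lvars_eq)
  then show ?thesis by (simp add: leval_def)
qed

lemma leval_zero [simp]: "leval v 0 = 0"
  using leval_diff[of v "cst 0" "cst 0"] by simp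

lemma leval_uminus [simp]: "leval v (- a) = - leval v a"
  using leval_diff[of v 0 a] by simp

lemma leval_sum [simp]: "leval v (\<Sum>x\<in>A. f x) = (\<Sum>x\<in>A. leval v (f x))"
  by (induction A rule: infinite_finite_induct) auto

lemma leval_lsubst [simp]: "leval v (lsubst \<sigma> e) = leval (\<lambda>x. leval v (\<sigma> x)) e"
  by (simp add: lsubst_def leval_def[of _ e])

lemma leval_cong: "(\<And>x. x \<in> lvars e \<Longrightarrow> v x = w x) \<Longrightarrow> leval v e = leval w e"
  by (simp add: leval_def)

lemma leval_single: "lvars e \<subseteq> {n} \<Longrightarrow> leval v e = coef e n * v n + fst e"
  using leval_superset[of "{n}" e v] by simp

text \<open>The zero valuation reveals the constant and the indicator of \<open>x\<close> then
  reveals the coefficient of \<open>x\<close>. Identities between substituted expressions thus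
  reduce to integer arithmetic.\<close>

lemma lexp_eq_leval:
  assumes "\<And>v. leval v a = leval v b"
  shows "a = b"
proof (rule lexp_eqI)
  have fst: "leval (\<lambda>_. 0) e = fst e" for e by (simp add: leval_def)
  show "fst a = fst b" using assms[of "\<lambda>_. 0"] by (simp add: fst)
  have coef: "leval (\<lambda>y. if y = x then 1 else 0) e = fst e + coef e x" for e x
    using leval_superset[of "insert x (lvars e)" e "\<lambda>y. if y = x then 1 else 0"]
    by (simp add: subset_insertI if_distrib sum.delta cong: if_cong)
  show "coef a x = coef b x" for x
    using assms[of "\<lambda>y. if y = x then 1 else 0"] \<open>fst a = fst b\<close> by (simp add: coef)
qed

lemma subschemata_refl [simp]: "\<phi> \<in> subschemata \<phi>"
  by (cases \<phi>) auto

lemma subschemata_trans: "\<chi> \<in> subschemata \<psi> \<Longrightarrow> \<psi> \<in> subschemata \<phi> \<Longrightarrow> \<chi> \<in> subschemata \<phi>"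
  by (induction \<phi>) auto

lemma finite_subschemata: "finite (subschemata \<phi>)"
  by (induction \<phi>) auto

lemma atoms_simps [simp]:
  "atoms Verum = {Verum}" "atoms Falsum = {Falsum}" "atoms (Less a b) = {Less a b}"
  "atoms (Prop p a) = {Prop p a}" "atoms (Neg \<phi>) = atoms \<phi>"
  "atoms (And \<phi> \<psi>) = atoms \<phi> \<union> atoms \<psi>" "atoms (Or \<phi> \<psi>) = atoms \<phi> \<union> atoms \<psi>"
  "atoms (BigAnd i a b \<phi>) = atoms \<phi>" "atoms (BigOr i a b \<phi>) = atoms \<phi>"
  by (auto simp: atoms_def)

lemma iterations_simps [simp]:
  "iterations Verum = {}" "iterations Falsum = {}" "iterations (Less a b) = {}"
  "iterations (Prop p a) = {}" "iterations (Neg \<phi>) = iterations \<phi>"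
  "iterations (And \<phi> \<psi>) = iterations \<phi> \<union> iterations \<psi>"
  "iterations (Or \<phi> \<psi>) = iterations \<phi> \<union> iterations \<psi>"
  "iterations (BigAnd i a b \<phi>) = insert (BigAnd i a b \<phi>) (iterations \<phi>)"
  "iterations (BigOr i a b \<phi>) = insert (BigOr i a b \<phi>) (iterations \<phi>)"
  by (auto simp: iterations_def iteration_over_def)

lemma is_arith_simps [simp]:
  "is_arith Verum" "is_arith Falsum" "is_arith (Less a b)" "\<not> is_arith (Prop p a)"
  "is_arith (Neg \<phi>) \<longleftrightarrow> is_arith \<phi>"
  "is_arith (And \<phi> \<psi>) \<longleftrightarrow> is_arith \<phi> \<and> is_arith \<psi>"
  "is_arith (Or \<phi> \<psi>) \<longleftrightarrow> is_arith \<phi> \<and> is_arith \<psi>"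
  "\<not> is_arith (BigAnd i a b \<phi>)" "\<not> is_arith (BigOr i a b \<phi>)"
  by (auto simp: is_arith_def)

lemma holds_cong: "(\<And>x. x \<in> free_vars \<chi> \<Longrightarrow> v x = w x) \<Longrightarrow> holds v \<chi> \<longleftrightarrow> holds w \<chi>"
proof (induction \<chi>)
  case (Less a b)
  then have "leval v a = leval w a" "leval v b = leval w b" by (auto intro: leval_cong)
  then show ?case by simp
qed auto

lemma holds_subst: "holds v (subst \<sigma> \<chi>) \<longleftrightarrow> holds (\<lambda>x. leval v (\<sigma> x)) \<chi>"
  by (induction \<chi> arbitrary: \<sigma>) auto

lemma same_schema_refl: "same_schema \<chi> \<chi>"
  by (induction \<chi>) (auto intro: same_schema.intros simp: arith_equiv_def)

lemma same_schema_arith: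
  assumes "same_schema \<chi> \<psi>" "is_arith \<psi>"
  shows "is_arith \<chi> \<and> (\<forall>v. (\<forall>x\<in>free_vars \<chi> \<union> free_vars \<psi>. 0 \<le> v x) \<longrightarrow> (holds v \<chi> \<longleftrightarrow> holds v \<psi>))"
  using assms by (induction rule: same_schema.induct) (auto simp: arith_equiv_def)

text \<open>The two iteration rules share one case. The bare constraint \<open>Less b a\<close>
  stems from the conjunctive rule only, but allowing it for both kinds keeps the later case analyses
  uniform.\<close>

lemma branch_step_cases [consumes 1, case_names And Or Iter Closure]:
  assumes "ST_branch_step B \<Phi> \<Psi>"
  obtains \<phi> \<psi> where "And \<phi> \<psi> \<in> \<Phi>" "\<Psi> = {\<phi>, \<psi>} \<union> (\<Phi> - {And \<phi> \<psi>})"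
  | \<phi> \<psi> \<chi> where "Or \<phi> \<psi> \<in> \<Phi>" "\<chi> \<in> {\<phi>, \<psi>}" "\<Psi> = {\<chi>} \<union> (\<Phi> - {Or \<phi> \<psi>})"
  | X Y i a b \<psi> where "X \<in> \<Phi>"
      "X = BigAnd i a b \<psi> \<and> Y = And (BigAnd i a (b - cst 1) \<psi>) (inst i b \<psi>) \<or>
       X = BigOr i a b \<psi> \<and> Y = Or (BigOr i a (b - cst 1) \<psi>) (inst i b \<psi>)"
      "\<Psi> = {Y, Leq a b} \<union> (\<Phi> - {X}) \<or> \<Psi> = {Less b a} \<union> (\<Phi> - {X})"
      "max_length_in \<Phi> X" "ST_saturated B \<Phi>"
  | p a b where "Prop p a \<in> \<Phi>" "Neg (Prop p b) \<in> \<Phi>" "\<Psi> = insert (Neq a b) \<Phi>"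
      "\<not> (\<exists>\<chi>\<in>B. same_schema \<chi> (Neq a b))"
proof -
  obtain r P Cs C where r: "rule B r P Cs" and *: "P \<subseteq> \<Phi>" "C \<in> set Cs" "\<Psi> = C \<union> (\<Phi> - P)"
    "r \<in> {RIterAnd, RIterOr} \<longrightarrow> (\<forall>\<chi>\<in>P. max_length_in \<Phi> \<chi>) \<and> ST_saturated B \<Phi>"
    using assms unfolding ST_branch_step_def by blast
  from r show ?thesis
  proof cases
    case (rule_and \<phi> \<psi>)
    with * show ?thesis by (intro that(1)[of \<phi> \<psi>]) auto
  next
    case (rule_or \<phi> \<psi>)
    with * consider "C = {\<phi>}" | "C = {\<psi>}" by auto
    then show ?thesis
      using rule_or * by cases (auto intro: that(2)[of \<phi> \<psi> \<phi>] that(2)[of \<phi> \<psi> \<psi>])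
  next
    case (rule_iter_and i a b \<phi>)
    with * show ?thesis
      by (intro that(3)[of "BigAnd i a b \<phi>" i a b \<phi> "And (BigAnd i a (b - cst 1) \<phi>) (inst i b \<phi>)"]) auto
  next
    case (rule_iter_or i a b \<phi>)
    with * show ?thesis
      by (intro that(3)[of "BigOr i a b \<phi>" i a b \<phi> "Or (BigOr i a (b - cst 1) \<phi>) (inst i b \<phi>)"]) auto
  next
    case (rule_closure a b p)
    with * show ?thesis by (intro that(4)[of p a b]) auto
  qed
qed

section \<open>Iterations of a regular schema\<close>

text \<open>The shape that regularity prescribes for a body over \<open>i\<close>, with symbols from
  \<open>Ps\<close> and offsets bounded by \<open>G\<close>; \<open>Verum\<close> and
  \<open>Falsum\<close> are excluded because every atom must be an indexed proposition.\<close>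

primrec iteration_body :: "nat set \<Rightarrow> int \<Rightarrow> nat \<Rightarrow> schema \<Rightarrow> bool" where
  "iteration_body Ps G i Verum = False"
| "iteration_body Ps G i Falsum = False"
| "iteration_body Ps G i (Less a b) = False"
| "iteration_body Ps G i (Prop p a) = (p \<in> Ps \<and> (\<exists>\<gamma>. a = var i + cst \<gamma> \<and> \<bar>\<gamma>\<bar> \<le> G))"
| "iteration_body Ps G i (Neg \<psi>) = (is_atom \<psi> \<and> iteration_body Ps G i \<psi>)"
| "iteration_body Ps G i (And \<psi> \<chi>) = (iteration_body Ps G i \<psi> \<and> iteration_body Ps G i \<chi>)"
| "iteration_body Ps G i (Or \<psi> \<chi>) = (iteration_body Ps G i \<psi> \<and> iteration_body Ps G i \<chi>)"
| "iteration_body Ps G i (BigAnd j a b \<psi>) = False"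
| "iteration_body Ps G i (BigOr j a b \<psi>) = False"

lemma iterations_body: "iteration_body Ps G i \<psi> \<Longrightarrow> iterations \<psi> = {}"
  by (induction \<psi>) auto

lemma lvars_var_cst: "lvars (var i + cst \<gamma>) = {i}"
  by (auto simp: lvars_eq)

lemma free_vars_body: "iteration_body Ps G i \<psi> \<Longrightarrow> free_vars \<psi> \<subseteq> {i}"
  by (induction \<psi>) (auto simp: lvars_var_cst)

text \<open>A body mentions no variable but \<open>i\<close>, so a shift of the parameter acts on an
  iteration through its bounds alone.\<close>

lemma subst_body:
  assumes "iteration_body Ps G i \<psi>"
  shows "subst (\<sigma>(i := var i)) \<psi> = \<psi>"
  using assms by (induction \<psi>) (auto intro!: lexp_eq_leval)

lemma literals_body:
  assumes "iteration_body Ps G i \<psi>" "Prop p a \<in> literals \<psi> \<or> Neg (Prop p a) \<in> literals \<psi>"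
  shows "\<exists>\<gamma>. a = var i + cst \<gamma> \<and> \<bar>\<gamma>\<bar> \<le> G"
  using assms
proof (induction \<psi>)
  case (Neg \<psi>)
  then show ?case by (cases \<psi>) auto
qed auto

section \<open>The invariant of labels\<close>

definition lit :: "bool \<Rightarrow> nat \<Rightarrow> lexp \<Rightarrow> schema" where
  "lit s p a = (if s then Prop p a else Neg (Prop p a))"

definition conn :: "bool \<Rightarrow> schema \<Rightarrow> schema \<Rightarrow> schema" where
  "conn c = (if c then And else Or)"

text \<open>The finite data of a regular schema: \<open>It\<close> holds its iterations as kind,
  variable and body, \<open>As\<close> the arguments of its literals outside iterations. Body
  offsets obey the tighter bound \<open>C - \<bar>\<beta>\<bar>\<close>, so that replacing the
  variable by n - \<beta> - k leaves constants of absolute value at most C + k.\<close>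

locale regular_frame =
  fixes n :: nat and \<alpha> \<beta> C :: int and It :: "(bool \<times> nat \<times> schema) set"
    and Ps :: "nat set" and As :: "lexp set"
  assumes finite_It: "finite It" and finite_Ps: "finite Ps" and finite_As: "finite As"
    and It: "(c, i, \<psi>) \<in> It \<Longrightarrow> i \<noteq> n \<and> iteration_body Ps (C - \<bar>\<beta>\<bar>) i \<psi>"
    and As: "a \<in> As \<Longrightarrow> lvars a \<subseteq> {n} \<and> \<bar>fst a\<bar> \<le> C"
    and C: "\<bar>\<alpha>\<bar> + \<bar>\<beta>\<bar> \<le> C"
begin

text \<open>An iteration of index \<open>k\<close> is one that has been unrolled \<open>k\<close> times.\<close>

definition bnd :: "nat \<Rightarrow> lexp" where
  "bnd k = var n - cst (\<beta> + int k)"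

definition itn :: "bool \<Rightarrow> nat \<Rightarrow> nat \<Rightarrow> schema \<Rightarrow> schema" where
  "itn c i k \<psi> = (if c then BigAnd else BigOr) i (cst \<alpha>) (bnd k) \<psi>"

text \<open>
  The indices of the iterations range over \<open>lo..hi\<close>. The bounds on the constants hold because
  unrolling an iteration of index \<open>j\<close> yields literals with arguments \<open>n - \<beta> - j + \<gamma>\<close>.
\<close>

primrec inv :: "nat \<Rightarrow> nat \<Rightarrow> schema \<Rightarrow> bool" where
  "inv lo hi Verum = True"
| "inv lo hi Falsum = True"
| "inv lo hi (Less a b) = (lvars a \<subseteq> {n} \<and> lvars b \<subseteq> {n} \<and> \<bar>fst a - fst b\<bar> \<le> int hi + 2 * C)"
| "inv lo hi (Prop p a) = (p \<in> Ps \<and>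
     (a \<in> As \<or> (\<exists>f. a = var n + cst f \<and> - (int hi + C) \<le> f \<and> f \<le> C)))"
| "inv lo hi (Neg \<phi>) = (is_atom \<phi> \<and> inv lo hi \<phi>)"
| "inv lo hi (And \<phi> \<psi>) = (inv lo hi \<phi> \<and> inv lo hi \<psi>)"
| "inv lo hi (Or \<phi> \<psi>) = (inv lo hi \<phi> \<and> inv lo hi \<psi>)"
| "inv lo hi (BigAnd i a b \<phi>) =
     ((True, i, \<phi>) \<in> It \<and> a = cst \<alpha> \<and> (\<exists>k. lo \<le> k \<and> k \<le> hi \<and> b = bnd k))"
| "inv lo hi (BigOr i a b \<phi>) =
     ((False, i, \<phi>) \<in> It \<and> a = cst \<alpha> \<and> (\<exists>k. lo \<le> k \<and> k \<le> hi \<and> b = bnd k))"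

lemma bnd_simps [simp]:
  "fst (bnd k) = - \<beta> - int k" "coef (bnd k) x = (if x = n then 1 else 0)"
  "leval v (bnd k) = v n - \<beta> - int k" "lvars (bnd k) = {n}"
  "bnd k - cst 1 = bnd (Suc k)"
  by (auto simp: bnd_def lvars_eq intro!: lexp_eq_leval)

lemma bnd_inject [simp]: "bnd k = bnd l \<longleftrightarrow> k = l"
proof
  assume "bnd k = bnd l"
  then have "fst (bnd k) = fst (bnd l)" by simp
  then show "k = l" by simp
qed simp

lemma C_nonneg: "0 \<le> C"
  using C by linarith

lemma inv_itn: "inv lo hi (itn c i k \<psi>) \<longleftrightarrow> (c, i, \<psi>) \<in> It \<and> lo \<le> k \<and> k \<le> hi"
  by (auto simp: itn_def)

lemma inv_mono:
  assumes "inv lo hi \<chi>" "lo' \<le> lo" "hi \<le> hi'"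
  shows "inv lo' hi' \<chi>"
  using assms(1)
proof (induction \<chi>)
  case (Prop p a)
  then show ?case
    using assms(3) by (auto; fastforce)
qed (use assms(2,3) in force)+

lemma inv_inst:
  assumes "iteration_body Ps (C - \<bar>\<beta>\<bar>) i \<psi>" "k \<le> hi"
  shows "inv lo hi (inst i (bnd k) \<psi>)"
  using assms(1)
proof (induction \<psi>)
  case (Prop p a)
  then obtain \<gamma> where \<gamma>: "a = var i + cst \<gamma>" "\<bar>\<gamma>\<bar> \<le> C - \<bar>\<beta>\<bar>" and p: "p \<in> Ps" by auto
  have "lsubst (var(i := bnd k)) a = var n + cst (\<gamma> - \<beta> - int k)"
    by (auto intro!: lexp_eq_leval simp: \<gamma>)
  then show ?case
    using p \<gamma>(2) assms(2) by (auto simp: inst_def intro!: exI[of _ "\<gamma> - \<beta> - int k"])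
next
  case (Neg \<psi>)
  then show ?case by (cases \<psi>) (auto simp: inst_def)
qed (auto simp: inst_def)

lemma free_vars_inv: "inv lo hi \<chi> \<Longrightarrow> free_vars \<chi> \<subseteq> {n}"
proof (induction \<chi>)
  case (Prop p a)
  then show ?case using As[of a] by (auto simp: lvars_var_cst)
next
  case (BigAnd i a b \<chi>)
  then show ?case using It[of True i \<chi>] free_vars_body[of Ps _ i \<chi>]
    by (auto simp: lvars_eq split: if_splits)
next
  case (BigOr i a b \<chi>)
  then show ?case using It[of False i \<chi>] free_vars_body[of Ps _ i \<chi>]
    by (auto simp: lvars_eq split: if_splits)
qed auto

lemma iterations_inv:
  assumes "inv lo hi \<chi>" "X \<in> iterations \<chi>"
  shows "\<exists>c i k \<psi>. X = itn c i k \<psi> \<and> (c, i, \<psi>) \<in> It \<and> lo \<le> k \<and> k \<le> hi"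
  using assms
proof (induction \<chi>)
  case (BigAnd i a b \<chi>)
  then have "X = BigAnd i a b \<chi>" using It[of True i \<chi>] iterations_body by auto
  with BigAnd.prems show ?case by (auto simp: itn_def intro!: exI[of _ True])
next
  case (BigOr i a b \<chi>)
  then have "X = BigOr i a b \<chi>" using It[of False i \<chi>] iterations_body by auto
  with BigOr.prems show ?case by (auto simp: itn_def intro!: exI[of _ False])
qed auto

lemma inv_raise:
  assumes "inv lo hi \<chi>" "\<And>c i k \<psi>. itn c i k \<psi> \<in> iterations \<chi> \<Longrightarrow> lo' \<le> k"
  shows "inv lo' hi \<chi>"
  using assms
proof (induction \<chi>)
  case (BigAnd i a b \<chi>)
  then obtain k where "a = cst \<alpha>" "b = bnd k" "lo \<le> k" "k \<le> hi" "(True, i, \<chi>) \<in> It" by auto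
  moreover from this BigAnd.prems(2)[of True i k \<chi>] have "lo' \<le> k" by (auto simp: itn_def)
  ultimately show ?case by auto
next
  case (BigOr i a b \<chi>)
  then obtain k where "a = cst \<alpha>" "b = bnd k" "lo \<le> k" "k \<le> hi" "(False, i, \<chi>) \<in> It" by auto
  moreover from this BigOr.prems(2)[of False i k \<chi>] have "lo' \<le> k" by (auto simp: itn_def)
  ultimately show ?case by auto
qed auto

lemma iteration_over_itn:
  "iteration_over (itn c i k \<psi>) j a b \<chi> \<longleftrightarrow> j = i \<and> a = cst \<alpha> \<and> b = bnd k \<and> \<chi> = \<psi>"
  by (auto simp: iteration_over_def itn_def)

text \<open>All iterations start at \<alpha>, so a longer one has a larger upper bound, that is, a
  smaller index.\<close>

lemma max_length_itn:
  assumes "max_length_in \<Phi> (itn c i k \<psi>)" "itn c' i' k' \<psi>' \<in> set_iterations \<Phi>"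
  shows "k \<le> k'"
proof (rule ccontr)
  assume "\<not> k \<le> k'"
  then have "lle (bnd k - cst \<alpha>) (bnd k' - cst \<alpha>)" "bnd k - cst \<alpha> \<noteq> bnd k' - cst \<alpha>"
    by (auto simp: lle_def)
  moreover have "\<forall>\<chi>'\<in>set_iterations \<Phi>. \<forall>i' a' b' \<psi>'. iteration_over \<chi>' i' a' b' \<psi>' \<longrightarrow>
      \<not> (lle (bnd k - cst \<alpha>) (b' - a') \<and> bnd k - cst \<alpha> \<noteq> b' - a')"
    using assms(1) unfolding max_length_in_def iteration_over_itn by blast
  moreover have "iteration_over (itn c' i' k' \<psi>') i' (cst \<alpha>) (bnd k') \<psi>'"
    by (simp add: iteration_over_itn)
  ultimately show False
    using assms(2) by blast
qed

lemma inv_fst: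
  assumes "inv lo hi (Prop p a)"
  shows "lvars a \<subseteq> {n}" "- (int hi + C) \<le> fst a" "fst a \<le> C"
  using assms As[of a] C_nonneg by (auto simp: lvars_var_cst)

text \<open>Both constants lie between -(hi + C) and C. This is the source of the bound hi + 2C that
  \<open>inv\<close> puts on comparisons.\<close>

lemma inv_Neq:
  assumes "inv lo hi (Prop p a)" "inv lo hi (Prop q b)"
  shows "inv lo hi (Neq a b)"
  using inv_fst[OF assms(1)] inv_fst[OF assms(2)] by auto

end

locale regular_branch = regular_frame +
  fixes L :: "nat \<Rightarrow> schema set"
  assumes ST_branch: "ST_branch L" and finite_L0: "finite (L 0)" and inv_L0: "\<And>\<chi>. \<chi> \<in> L 0 \<Longrightarrow> inv 0 0 \<chi>"
begin

text \<open>The times at which labels are compared later on: just before an unrolling the label is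
  saturated, and \<open>k\<close> is its smallest index.\<close>

definition iter_at :: "nat \<Rightarrow> nat \<Rightarrow> bool" where
  "iter_at t k \<longleftrightarrow> ST_saturated (\<Union>s\<le>t. L s) (L t) \<and> (\<exists>c i \<psi>. (c, i, \<psi>) \<in> It \<and>
     itn c i k \<psi> \<in> L t \<and> max_length_in (L t) (itn c i k \<psi>) \<and>
     (L (Suc t) = {conn c (itn c i (Suc k) \<psi>) (inst i (bnd k) \<psi>), Leq (cst \<alpha>) (bnd k)} \<union> (L t - {itn c i k \<psi>}) \<or>
      L (Suc t) = {Less (bnd k) (cst \<alpha>)} \<union> (L t - {itn c i k \<psi>})))"

lemma step_cases_inv [consumes 1, case_names And Or Iter Closure]:
  assumes "\<forall>\<chi>\<in>L t. inv lo hi \<chi>"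
  obtains \<phi> \<psi> where "And \<phi> \<psi> \<in> L t" "L (Suc t) = {\<phi>, \<psi>} \<union> (L t - {And \<phi> \<psi>})"
  | \<phi> \<psi> \<chi> where "Or \<phi> \<psi> \<in> L t" "\<chi> \<in> {\<phi>, \<psi>}" "L (Suc t) = {\<chi>} \<union> (L t - {Or \<phi> \<psi>})"
  | k where "iter_at t k"
  | p a b where "Prop p a \<in> L t" "Neg (Prop p b) \<in> L t" "L (Suc t) = insert (Neq a b) (L t)"
      "\<not> (\<exists>\<chi>\<in>(\<Union>s\<le>t. L s). same_schema \<chi> (Neq a b))"
proof -
  have "ST_branch_step (\<Union>s\<le>t. L s) (L t) (L (Suc t))"
    using ST_branch by (simp add: ST_branch_def)
  then show ?thesis
  proof (cases rule: branch_step_cases)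
    case (Iter X Y i a b \<psi>)
    obtain c k where
      "X = itn c i k \<psi>" "(c, i, \<psi>) \<in> It" "a = cst \<alpha>" "b = bnd k"
      "Y = conn c (itn c i (Suc k) \<psi>) (inst i b \<psi>)"
    proof -
      from Iter(2) show thesis
      proof (elim disjE conjE)
        assume X: "X = BigAnd i a b \<psi>" "Y = And (BigAnd i a (b - cst 1) \<psi>) (inst i b \<psi>)"
        with assms Iter(1) obtain k where "(True, i, \<psi>) \<in> It" "a = cst \<alpha>" "b = bnd k" by fastforce
        with X show thesis by (intro that[of True k]) (auto simp: itn_def conn_def)
      next
        assume X: "X = BigOr i a b \<psi>" "Y = Or (BigOr i a (b - cst 1) \<psi>) (inst i b \<psi>)"
        with assms Iter(1) obtain k where "(False, i, \<psi>) \<in> It" "a = cst \<alpha>" "b = bnd k" by fastforce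
        with X show thesis by (intro that[of False k]) (auto simp: itn_def conn_def)
      qed
    qed
    note X = this
    have "itn c i k \<psi> \<in> L t \<and> max_length_in (L t) (itn c i k \<psi>)"
      using Iter(1,4) X(1) by simp
    moreover have "L (Suc t) = {conn c (itn c i (Suc k) \<psi>) (inst i (bnd k) \<psi>), Leq (cst \<alpha>) (bnd k)} \<union> (L t - {itn c i k \<psi>}) \<or>
      L (Suc t) = {Less (bnd k) (cst \<alpha>)} \<union> (L t - {itn c i k \<psi>})"
      using Iter(3) unfolding X by simp
    ultimately have "iter_at t k" unfolding iter_at_def using Iter(5) X(2) by blast
    then show ?thesis by (rule that(3))
  next
    case (And \<phi> \<psi>)
    then show ?thesis by (rule that(1))
  next
    case (Or \<phi> \<psi> \<chi>)
    then show ?thesis by (rule that(2))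
  next
    case (Closure p a b)
    then show ?thesis by (rule that(4))
  qed
qed

end

section \<open>Indices along a branch\<close>

context regular_branch
begin

abbreviation inv_at :: "nat \<Rightarrow> nat \<Rightarrow> nat \<Rightarrow> bool" where
  "inv_at lo hi t \<equiv> \<forall>\<chi>\<in>L t. inv lo hi \<chi>"

lemma iter_atE:
  assumes "iter_at t k"
  obtains c i \<psi> \<Psi> where "(c, i, \<psi>) \<in> It" "itn c i k \<psi> \<in> L t" "max_length_in (L t) (itn c i k \<psi>)"
    "L (Suc t) = \<Psi> \<union> (L t - {itn c i k \<psi>})"
    "\<Psi> = {conn c (itn c i (Suc k) \<psi>) (inst i (bnd k) \<psi>), Leq (cst \<alpha>) (bnd k)} \<or>
     \<Psi> = {Less (bnd k) (cst \<alpha>)}"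
  using assms unfolding iter_at_def by blast

lemma inv_at_Suc:
  assumes inv: "inv_at lo hi t" and hi: "\<And>k. iter_at t k \<Longrightarrow> Suc k \<le> hi"
  shows "inv_at lo hi (Suc t)"
proof -
  from inv show ?thesis
  proof (cases rule: step_cases_inv)
    case (And \<phi> \<psi>)
    then show ?thesis using inv by auto
  next
    case (Or \<phi> \<psi> \<chi>)
    then show ?thesis using inv by auto
  next
    case (Closure p a b)
    then have "inv lo hi (Prop p a)" "inv lo hi (Neg (Prop p b))" using inv by blast+
    then have "inv lo hi (Neq a b)" using inv_Neq[of lo hi p a p b] by (simp only: inv.simps)
    with inv show ?thesis unfolding Closure(3) by (simp only: ball_simps)
  next
    case (Iter k)
    then obtain c i \<psi> \<Psi> where *: "(c, i, \<psi>) \<in> It" "itn c i k \<psi> \<in> L t"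
      "L (Suc t) = \<Psi> \<union> (L t - {itn c i k \<psi>})"
      "\<Psi> = {conn c (itn c i (Suc k) \<psi>) (inst i (bnd k) \<psi>), Leq (cst \<alpha>) (bnd k)} \<or>
       \<Psi> = {Less (bnd k) (cst \<alpha>)}"
      by (rule iter_atE)
    have "Suc k \<le> hi" using hi[OF Iter] .
    moreover have "lo \<le> k" using inv *(2) inv_itn by blast
    ultimately have "inv lo hi (itn c i (Suc k) \<psi>)" "inv lo hi (inst i (bnd k) \<psi>)"
      using *(1) It by (auto simp: inv_itn intro: inv_inst)
    then have "inv lo hi (conn c (itn c i (Suc k) \<psi>) (inst i (bnd k) \<psi>))"
      by (cases c) (simp_all add: conn_def)
    moreover have "inv lo hi (Less (bnd k) (cst \<alpha>))"
      using \<open>Suc k \<le> hi\<close> C by (auto simp: lvars_eq split: if_splits)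
    moreover from this have "inv lo hi (Leq (cst \<alpha>) (bnd k))" by simp
    ultimately have "\<forall>\<chi>\<in>\<Psi>. inv lo hi \<chi>" using *(4) by blast
    with inv show ?thesis unfolding *(3) by blast
  qed
qed

lemma itn_iterations: "itn c i k \<psi> \<in> iterations (itn c i k \<psi>)"
  by (simp add: itn_def)

lemma inv_at_iter:
  assumes "inv_at lo hi t" "iter_at t k"
  shows "inv_at k hi t"
proof
  fix \<chi> assume \<chi>: "\<chi> \<in> L t"
  with assms(1) have "inv lo hi \<chi>" by blast
  then show "inv k hi \<chi>"
  proof (rule inv_raise)
    fix c i l \<psi> assume "itn c i l \<psi> \<in> iterations \<chi>"
    with \<chi> have l: "itn c i l \<psi> \<in> set_iterations (L t)" by (auto simp: set_iterations_def)
    obtain c' i' \<psi>' where "max_length_in (L t) (itn c' i' k \<psi>')"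
      using assms(2) by (rule iter_atE)
    from max_length_itn[OF this l] show "k \<le> l" .
  qed
qed

lemma iter_index_le:
  assumes "inv_at lo hi t" "iter_at t k"
  shows "lo \<le> k" "k \<le> hi"
  using assms inv_itn by (auto elim!: iter_atE)

text \<open>As the smallest index is always unrolled first, an index k + 1 can only arise when all
  indices are at least k; hence a label never spreads over more than two consecutive
  indices.\<close>

lemma ex_inv_at: "\<exists>k. inv_at k (Suc k) t"
proof (induction t)
  case 0
  then show ?case using inv_L0 inv_mono[of 0 0 _ 0 "Suc 0"] by auto
next
  case (Suc t)
  then obtain K where K: "inv_at K (Suc K) t" by blast
  show ?case
  proof (cases "\<exists>k. iter_at t k")
    case True
    then obtain k where k: "iter_at t k" by blast
    have k': "inv_at k (Suc K) t" by (rule inv_at_iter[OF K k])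
    have "K \<le> k" using iter_index_le[OF K k] by simp
    with k' have k'': "inv_at k (Suc k) t" using inv_mono by (meson Suc_le_mono order_refl)
    \<comment> \<open>A priori \<open>iter_at\<close> might hold at \<open>t\<close> for another
      index \<open>l\<close> too; the minimality of \<open>l\<close> gives l \<le> k.\<close>
    moreover have "Suc l \<le> Suc k" if "iter_at t l" for l
      using iter_index_le[OF inv_at_iter[OF k'' that] k] by simp
    ultimately show ?thesis using inv_at_Suc by blast
  next
    case False
    with K show ?thesis using inv_at_Suc by blast
  qed
qed

lemma iter_inv_at:
  assumes "iter_at t k"
  shows "inv_at k (Suc k) t"
proof -
  obtain K where K: "inv_at K (Suc K) t" using ex_inv_at by blast
  have "inv_at k (Suc K) t" by (rule inv_at_iter[OF K assms])
  moreover have "K \<le> k" using iter_index_le[OF K assms] by simp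
  ultimately show ?thesis using inv_mono by (meson Suc_le_mono order_refl)
qed

lemma inv_at_mono:
  assumes "inv_at lo hi s" "s \<le> t"
  shows "\<exists>hi'. inv_at lo hi' t"
  using assms(2)
proof (induction t rule: dec_induct)
  case (step t)
  then obtain h where h: "inv_at lo h t" by blast
  obtain K where K: "inv_at K (Suc K) t" using ex_inv_at by blast
  \<comment> \<open>K + 2 is the largest index that an unrolling at \<open>t\<close> can create;
    adding it to \<open>h\<close> covers both the old label and the new one.\<close>
  from h have "inv_at lo (h + Suc (Suc K)) t" using inv_mono by (meson le_add1 order_refl)
  moreover have "Suc k \<le> h + Suc (Suc K)" if "iter_at t k" for k
    using iter_index_le[OF K that] by simp
  ultimately show ?case using inv_at_Suc by blast
qed (use assms(1) in blast)

lemma iter_mono: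
  assumes "iter_at s k" "iter_at t l" "s \<le> t"
  shows "k \<le> l"
  using inv_at_mono[OF iter_inv_at[OF assms(1)] assms(3)] iter_index_le(1)[OF _ assms(2)] by blast

section \<open>Unboundedness of the indices\<close>

lemma finite_L: "finite (L t)"
proof (induction t)
  case (Suc t)
  obtain K where "inv_at K (Suc K) t" using ex_inv_at by blast
  then show ?case
  proof (cases rule: step_cases_inv)
    case (Iter k)
    then show ?thesis using Suc by (auto elim!: iter_atE)
  qed (use Suc in auto)
qed (rule finite_L0)

text \<open>
  The first factor in the weight of an iteration of index \<open>k\<close> is \<open>M + 2 - k\<close>; it decreases
  with every unrolling as long as \<open>k \<le> M\<close>, and is truncated to 0 afterwards.
\<close>

primrec weight :: "nat \<Rightarrow> schema \<Rightarrow> nat" where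
  "weight M Verum = 1"
| "weight M Falsum = 1"
| "weight M (Less a b) = 1"
| "weight M (Prop p a) = 1"
| "weight M (Neg \<phi>) = 1"
| "weight M (And \<phi> \<psi>) = Suc (weight M \<phi> + weight M \<psi>)"
| "weight M (Or \<phi> \<psi>) = Suc (weight M \<phi> + weight M \<psi>)"
| "weight M (BigAnd i a b \<phi>) = Suc (nat (fst b + \<beta> + int M + 2) * (weight M \<phi> + 10))"
| "weight M (BigOr i a b \<phi>) = Suc (nat (fst b + \<beta> + int M + 2) * (weight M \<phi> + 10))"

lemma weight_inst: "iteration_body Qs G j \<psi> \<Longrightarrow> weight M (inst i e \<psi>) = weight M \<psi>"
  unfolding inst_def by (induction \<psi>) auto

text \<open>One more unrolling lowers the first factor by one and releases the weight of the body
  plus 10, which pays for the instance, the new connective and the added constraint.\<close>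

lemma weight_unroll:
  assumes "(c, i, \<psi>) \<in> It" "k \<le> M"
  shows "weight M (conn c (itn c i (Suc k) \<psi>) (inst i (bnd k) \<psi>)) + 1 < weight M (itn c i k \<psi>)"
proof -
  have "weight M (inst i (bnd k) \<psi>) = weight M \<psi>"
    using It[OF assms(1)] weight_inst by blast
  moreover have "nat (int M + 2 - int k) = Suc (nat (int M + 1 - int k))"
    using assms(2) by linarith
  ultimately show ?thesis by (auto simp: conn_def itn_def algebra_simps)
qed

text \<open>The multiset argument carried out on sets: a conclusion that is already in the label
  only makes the new sum smaller.\<close>

lemma sum_exchange:
  fixes w :: "'a \<Rightarrow> nat"
  assumes "finite A" "x \<in> A" "finite B" "sum w B < w x"
  shows "sum w (B \<union> (A - {x})) < sum w A"
proof -
  have "sum w (B \<union> (A - {x})) \<le> sum w B + sum w (A - {x})"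
    using assms by (subst sum_Un_nat) auto
  also have "\<dots> < w x + sum w (A - {x})" using assms by simp
  also have "\<dots> = sum w A" using assms by (simp add: sum.remove)
  finally show ?thesis .
qed

text \<open>With indices bounded by \<open>M\<close> the literal arguments form a finite set, and
  closure acts at most once on each pair of them. After the last closure every step would lower the
  total weight.\<close>

lemma iter_index_unbounded: "\<exists>t k. iter_at t k \<and> M < k"
proof (rule ccontr)
  assume "\<not> ?thesis"
  then have M: "k \<le> M" if "iter_at t k" for t k using that by (meson not_le)
  have inv: "inv_at 0 (Suc M) t" for t
  proof (induction t)
    case 0
    then show ?case using inv_L0 inv_mono[of 0 0 _ 0 "Suc M"] by auto
  next
    case (Suc t)
    then show ?case by (rule inv_at_Suc) (use M in auto)
  qed
  define args where "args = As \<union> (\<lambda>f. var n + cst f) ` {- (int (Suc M) + C)..C}"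
  have args: "a \<in> args" if "Prop p a \<in> L t \<or> Neg (Prop p a) \<in> L t" for p a t
    using that inv[of t] unfolding args_def by force
  define cl where "cl t ab \<longleftrightarrow> (\<exists>p. Prop p (fst ab) \<in> L t \<and> Neg (Prop p (snd ab)) \<in> L t) \<and>
    L (Suc t) = insert (Neq (fst ab) (snd ab)) (L t) \<and>
    \<not> (\<exists>\<chi>\<in>(\<Union>s\<le>t. L s). same_schema \<chi> (Neq (fst ab) (snd ab)))" for t ab
  define T where "T = {t. \<exists>ab. cl t ab}"
  define g where "g t = (SOME ab. cl t ab)" for t
  have g: "cl t (g t)" if "t \<in> T" for t
    using that unfolding T_def g_def by (auto intro: someI_ex)
  \<comment> \<open>The earlier closure puts on the branch the very inequality whose absence the
    later one requires.\<close>
  have neq: "g s \<noteq> g t" if "s \<in> T" "t \<in> T" "s < t" for s t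
  proof
    assume eq: "g s = g t"
    have "Neq (fst (g t)) (snd (g t)) \<in> L (Suc s)"
      using g[OF that(1)] unfolding cl_def eq by blast
    then show False
      using g[OF that(2)] same_schema_refl that(3) unfolding cl_def by (meson Suc_leI UN_I atMost_iff)
  qed
  have "inj_on g T"
    by (rule inj_onI) (metis neq linorder_neqE_nat)
  moreover have "g ` T \<subseteq> args \<times> args"
  proof
    fix ab assume "ab \<in> g ` T"
    then obtain t where "cl t ab" using g by blast
    then show "ab \<in> args \<times> args"
      using args unfolding cl_def by (cases ab) auto
  qed
  moreover have "finite (args \<times> args)" by (simp add: args_def finite_As)
  ultimately have "finite T" using inj_on_finite by blast
  then obtain t0 where t0: "\<And>t. t \<in> T \<Longrightarrow> t < t0"
    using finite_nat_set_iff_bounded by auto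
  have dec: "sum (weight M) (L (Suc t)) < sum (weight M) (L t)" if "t0 \<le> t" for t
  proof -
    from inv[of t] show ?thesis
    proof (cases rule: step_cases_inv)
      case (And \<phi> \<psi>)
      have "sum (weight M) {\<phi>, \<psi>} \<le> weight M \<phi> + weight M \<psi>"
        by (cases "\<phi> = \<psi>") auto
      then show ?thesis
        unfolding And(2) by (intro sum_exchange finite_L And(1)) auto
    next
      case (Or \<phi> \<psi> \<chi>)
      then show ?thesis
        unfolding Or(3) by (intro sum_exchange finite_L Or(1)) auto
    next
      case (Iter k)
      then obtain c i \<psi> \<Psi> where *: "(c, i, \<psi>) \<in> It" "itn c i k \<psi> \<in> L t"
        "L (Suc t) = \<Psi> \<union> (L t - {itn c i k \<psi>})"
        "\<Psi> = {conn c (itn c i (Suc k) \<psi>) (inst i (bnd k) \<psi>), Leq (cst \<alpha>) (bnd k)} \<or>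
         \<Psi> = {Less (bnd k) (cst \<alpha>)}"
        by (rule iter_atE)
      have w: "weight M (conn c (itn c i (Suc k) \<psi>) (inst i (bnd k) \<psi>)) + 1 < weight M (itn c i k \<psi>)"
        by (rule weight_unroll[OF *(1) M[OF Iter]])
      have "conn c (itn c i (Suc k) \<psi>) (inst i (bnd k) \<psi>) \<noteq> Leq (cst \<alpha>) (bnd k)"
        by (simp add: conn_def)
      then have "sum (weight M) \<Psi> < weight M (itn c i k \<psi>)" "finite \<Psi>"
        using *(4) w by auto
      then show ?thesis unfolding *(3) by (intro sum_exchange finite_L *(2)) auto
    next
      case (Closure p a b)
      then have "cl t (a, b)" unfolding cl_def fst_conv snd_conv by blast
      then have "t \<in> T" unfolding T_def by blast
      with t0 that show ?thesis by (meson not_le)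
    qed
  qed
  have "sum (weight M) (L (t0 + j)) + j \<le> sum (weight M) (L t0)" for j
  proof (induction j)
    case (Suc j)
    with dec[of "t0 + j"] show ?case by simp
  qed simp
  from this[of "Suc (sum (weight M) (L t0))"] show False by simp
qed

end

section \<open>Constraints on the parameter\<close>

text \<open>A negative slope would violate the inequality for all large x. With slope 0 the
  inequality does not depend on x, and with slope at least 1 every x beyond \<open>H\<close>
  satisfies it.\<close>

lemma linear_up_closed:
  fixes u w H :: int
  assumes "\<And>z. \<exists>x\<ge>z. w < u * x"
  shows "x \<le> y \<Longrightarrow> w < u * x \<Longrightarrow> w < u * y"
    and "w \<le> H \<Longrightarrow> 0 \<le> H \<Longrightarrow> H < x \<Longrightarrow> w < u * x"
proof -
  have u: "0 \<le> u"
  proof (rule ccontr)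
    assume "\<not> 0 \<le> u"
    then have u: "u \<le> -1" by simp
    obtain x where x: "max 0 (- w) \<le> x" "w < u * x" using assms by blast
    then have "u * x \<le> -1 * x" using u by (intro mult_right_mono) auto
    with x show False by simp
  qed
  show "w < u * y" if "x \<le> y" "w < u * x"
    using mult_left_mono[OF that(1) u] that(2) by linarith
  show "w < u * x" if "w \<le> H" "0 \<le> H" "H < x"
  proof (cases "u = 0")
    case True
    with assms[of 0] show ?thesis by auto
  next
    case False
    with u have "1 * x \<le> u * x" using that by (intro mult_right_mono) auto
    with that show ?thesis by linarith
  qed
qed

section \<open>Solution sets of the labels\<close>

context regular_branch
begin

text \<open>The admissible values of the parameter. Constant valuations are enough, since
  \<open>n\<close> is the only variable free in a label.\<close>

definition sols :: "nat \<Rightarrow> int set" where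
  "sols t = {x. 0 \<le> x \<and> (\<forall>\<chi>\<in>arith_part (L t). holds (\<lambda>_. x) \<chi>)}"

text \<open>A rule may discard a compound arithmetic formula, but then its conclusion implies that
  formula; an iteration is never arithmetic. So constraints accumulate along the branch.\<close>

lemma sat_Suc:
  assumes "\<forall>\<chi>\<in>arith_part (L (Suc t)). holds v \<chi>"
  shows "\<forall>\<chi>\<in>arith_part (L t). holds v \<chi>"
proof -
  have sat: "holds v \<chi>" if "\<chi> \<in> L (Suc t)" "is_arith \<chi>" for \<chi>
    using assms that by (simp add: arith_part_def)
  have "holds v \<chi>" if "\<chi> \<in> L t" "is_arith \<chi>" for \<chi>
  proof -
    obtain K where "inv_at K (Suc K) t" using ex_inv_at by blast
    then show ?thesis
    proof (cases rule: step_cases_inv)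
      case (And \<phi> \<psi>)
      show ?thesis
      proof (cases "\<chi> = And \<phi> \<psi>")
        case True
        with sat[of \<phi>] sat[of \<psi>] And(2) that(2) show ?thesis by simp
      next
        case False
        with sat[of \<chi>] And(2) that show ?thesis by simp
      qed
    next
      case (Or \<phi> \<psi> \<xi>)
      show ?thesis
      proof (cases "\<chi> = Or \<phi> \<psi>")
        case True
        with sat[of \<xi>] Or(2,3) that(2) show ?thesis by auto
      next
        case False
        with sat[of \<chi>] Or(3) that show ?thesis by simp
      qed
    next
      case (Iter k)
      then obtain c i \<psi> \<Psi> where *: "L (Suc t) = \<Psi> \<union> (L t - {itn c i k \<psi>})"
        by (rule iter_atE)
      have "\<chi> \<noteq> itn c i k \<psi>" using that(2) by (auto simp: itn_def)
      with sat[of \<chi>] * that show ?thesis by simp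
    next
      case (Closure p a b)
      with sat[of \<chi>] that show ?thesis by simp
    qed
  qed
  then show ?thesis by (simp add: arith_part_def)
qed

lemma sat_mono:
  assumes "\<forall>\<chi>\<in>arith_part (L t). holds v \<chi>" "s \<le> t"
  shows "\<forall>\<chi>\<in>arith_part (L s). holds v \<chi>"
  using assms(2,1)
proof (induction t rule: dec_induct)
  case (step t)
  then show ?case using sat_Suc by blast
qed

lemma sols_antimono: "s \<le> t \<Longrightarrow> sols t \<subseteq> sols s"
  unfolding sols_def using sat_mono by blast

lemma free_vars_L: "\<chi> \<in> L t \<Longrightarrow> free_vars \<chi> \<subseteq> {n}"
  using ex_inv_at[of t] free_vars_inv by blast

lemma holds_L: "\<chi> \<in> L t \<Longrightarrow> holds v \<chi> \<longleftrightarrow> holds (\<lambda>_. v n) \<chi>"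
  using free_vars_L by (intro holds_cong) auto

lemma sols_iff_sat: "v n \<in> sols t \<longleftrightarrow> 0 \<le> v n \<and> (\<forall>\<chi>\<in>arith_part (L t). holds v \<chi>)"
  using holds_L[of _ t v] by (auto simp: sols_def arith_part_def)

text \<open>An iteration of index k > 0 was created by unrolling one of index k - 1, which added
  \<alpha> \<le> n - \<beta> - (k - 1); solutions of later labels still satisfy this
  constraint.\<close>

lemma sols_lower:
  assumes "x \<in> sols t" "itn c i k \<psi> \<in> set_iterations (L t)"
  shows "k = 0 \<or> \<alpha> + \<beta> + int k \<le> x + 1"
proof -
  define good where "good \<chi> \<longleftrightarrow>
    (\<forall>c i k \<psi>. itn c i k \<psi> \<in> iterations \<chi> \<longrightarrow> k = 0 \<or> \<alpha> + \<beta> + int k \<le> x + 1)" for \<chi>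
  have sub: "good \<chi>" if "good \<chi>'" "iterations \<chi> \<subseteq> iterations \<chi>'" for \<chi> \<chi>'
    using that unfolding good_def by blast
  have "\<forall>\<chi>\<in>L t. good \<chi>"
    using assms(1)
  proof (induction t)
    case 0
    have "k = 0" if \<chi>: "\<chi> \<in> L 0" "itn c i k \<psi> \<in> iterations \<chi>" for \<chi> c i k \<psi>
      using iterations_inv[OF inv_L0[OF \<chi>(1)] \<chi>(2)]
      by (auto simp: itn_def split: if_splits)
    then show ?case by (auto simp: good_def)
  next
    case (Suc t)
    have "x \<in> sols t" using Suc.prems sols_antimono[OF le_SucI[OF order_refl]] by blast
    then have IH: "\<forall>\<chi>\<in>L t. good \<chi>" by (rule Suc.IH)
    obtain K where "inv_at K (Suc K) t" using ex_inv_at by blast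
    then show ?case
    proof (cases rule: step_cases_inv)
      case (And \<phi> \<psi>)
      show ?thesis unfolding And(2)
        using IH sub[OF bspec[OF IH And(1)], of \<phi>] sub[OF bspec[OF IH And(1)], of \<psi>] by simp
    next
      case (Or \<phi> \<psi> \<chi>)
      show ?thesis unfolding Or(3)
        using IH sub[OF bspec[OF IH Or(1)], of \<chi>] Or(2) by auto
    next
      case (Closure p a b)
      show ?thesis unfolding Closure(3) using IH by (simp add: good_def)
    next
      case (Iter k)
      then obtain c i \<psi> \<Psi> where *: "(c, i, \<psi>) \<in> It" "itn c i k \<psi> \<in> L t"
        "L (Suc t) = \<Psi> \<union> (L t - {itn c i k \<psi>})"
        "\<Psi> = {conn c (itn c i (Suc k) \<psi>) (inst i (bnd k) \<psi>), Leq (cst \<alpha>) (bnd k)} \<or>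
         \<Psi> = {Less (bnd k) (cst \<alpha>)}"
        by (rule iter_atE)
      have body: "iteration_body Ps (C - \<bar>\<beta>\<bar>) i \<psi>" using It *(1) by blast
      have "iteration_body Ps (C - \<bar>\<beta>\<bar>) i \<chi> \<Longrightarrow> iterations (inst i (bnd k) \<chi>) = {}" for \<chi>
        unfolding inst_def by (induction \<chi>) auto
      from this[OF body] have no: "iterations (inst i (bnd k) \<psi>) = {}" .
      have its: "iterations (conn c (itn c i (Suc k) \<psi>) (inst i (bnd k) \<psi>)) = {itn c i (Suc k) \<psi>}"
        using no iterations_body[OF body] by (auto simp: conn_def itn_def)
      \<comment> \<open>Only the conclusion with the new connective contains an iteration, and it
        comes together with the constraint on the bounds.\<close>
      have new: "l = 0 \<or> \<alpha> + \<beta> + int l \<le> x + 1"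
        if "\<chi> \<in> \<Psi>" "itn d j l \<xi> \<in> iterations \<chi>" for \<chi> d j l \<xi>
      proof -
        have "\<Psi> = {conn c (itn c i (Suc k) \<psi>) (inst i (bnd k) \<psi>), Leq (cst \<alpha>) (bnd k)}"
          using *(4) that by auto
        then have "Leq (cst \<alpha>) (bnd k) \<in> arith_part (L (Suc t))" and
          "\<chi> = conn c (itn c i (Suc k) \<psi>) (inst i (bnd k) \<psi>)"
          using *(3) that by (auto simp: arith_part_def)
        then have "holds (\<lambda>_. x) (Leq (cst \<alpha>) (bnd k))" "itn d j l \<xi> = itn c i (Suc k) \<psi>"
          using Suc.prems its that(2) by (auto simp: sols_def)
        then have "\<alpha> \<le> x - \<beta> - int k" "l = Suc k"
          by (auto simp: itn_def split: if_splits)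
        then show ?thesis by simp
      qed
      show ?thesis unfolding *(3) using IH new by (meson DiffD1 UnE good_def)
    qed
  qed
  then show ?thesis using assms(2) unfolding set_iterations_def good_def by blast
qed

text \<open>Satisfiability and entailment make only free variables nonnegative. The iteration about
  to be unrolled has \<open>n\<close> in its upper bound.\<close>

lemma n_free:
  assumes "iter_at t k"
  shows "n \<in> set_free_vars (L t)"
proof -
  from assms obtain c i \<psi> where "itn c i k \<psi> \<in> L t" by (rule iter_atE)
  moreover have "n \<in> free_vars (itn c i k \<psi>)" by (simp add: itn_def)
  ultimately show ?thesis by (auto simp: set_free_vars_def)
qed

lemma sols_nonempty:
  assumes "iter_at t k"
  shows "\<exists>x. x \<in> sols t"
proof -
  have "arith_sat (set_free_vars (L t)) (arith_part (L t))"
    using ST_branch by (simp add: ST_branch_def)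
  then obtain v where "\<forall>x\<in>set_free_vars (L t). 0 \<le> v x" "\<forall>\<chi>\<in>arith_part (L t). holds v \<chi>"
    by (auto simp: arith_sat_def)
  then have "v n \<in> sols t" using n_free[OF assms] by (simp add: sols_iff_sat)
  then show ?thesis ..
qed

lemma sols_lower_iter:
  assumes "iter_at t k" "x \<in> sols t" "0 < k"
  shows "\<alpha> + \<beta> + int k \<le> x + 1"
proof -
  from assms(1) obtain c i \<psi> where "itn c i k \<psi> \<in> L t" by (rule iter_atE)
  then have "itn c i k \<psi> \<in> set_iterations (L t)"
    using itn_iterations unfolding set_iterations_def by blast
  from sols_lower[OF assms(2) this] assms(3) show ?thesis by simp
qed

text \<open>Later unrollings of large index have only large solutions, and these also solve the
  current label because solution sets shrink along the branch.\<close>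

lemma sols_unbounded:
  assumes "iter_at t l"
  shows "\<exists>x\<ge>z. x \<in> sols t"
proof -
  \<comment> \<open>The summand \<open>l\<close> places \<open>t'\<close> after \<open>t\<close>;
    the rest makes \<alpha> + \<beta> + k - 1 exceed \<open>z\<close>.\<close>
  obtain t' k where k: "iter_at t' k" "l + Suc (nat (z - \<alpha> - \<beta>)) < k"
    using iter_index_unbounded by blast
  have "t \<le> t'"
    using iter_mono[OF k(1) assms] k(2) by force
  obtain x where x: "x \<in> sols t'" using sols_nonempty[OF k(1)] by blast
  have "z \<le> x" using sols_lower_iter[OF k(1) x] k(2) by linarith
  with x sols_antimono[OF \<open>t \<le> t'\<close>] show ?thesis by blast
qed

text \<open>Saturation excludes conjunctions and disjunctions, leaving atoms, negated atoms and
  iterations of the two possible indices.\<close>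

lemma saturated_L:
  assumes "iter_at t k" "\<chi> \<in> L t"
  obtains "is_atom \<chi>" | \<chi>' where "is_atom \<chi>'" "\<chi> = Neg \<chi>'"
  | c i j \<psi> where "\<chi> = itn c i j \<psi>" "(c, i, \<psi>) \<in> It" "k \<le> j" "j \<le> Suc k"
proof -
  have sat: "ST_saturated (\<Union>s\<le>t. L s) (L t)"
    using assms(1) by (simp add: iter_at_def)
  have "\<chi> \<noteq> And \<phi> \<psi>" for \<phi> \<psi>
    using sat rule_and[of _ \<phi> \<psi>] assms(2) unfolding ST_saturated_def by blast
  moreover have "\<chi> \<noteq> Or \<phi> \<psi>" for \<phi> \<psi>
    using sat rule_or[of _ \<phi> \<psi>] assms(2) unfolding ST_saturated_def by blast
  moreover have inv: "inv k (Suc k) \<chi>" using iter_inv_at[OF assms(1)] assms(2) by blast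
  ultimately show ?thesis
  proof (cases \<chi>)
    case (Neg \<chi>')
    with inv have "is_atom \<chi>'" by simp
    then show ?thesis using Neg by (rule that(2))
  next
    case (BigAnd i a b \<psi>)
    with inv obtain j where "b = bnd j" "k \<le> j" "j \<le> Suc k" "a = cst \<alpha>" "(True, i, \<psi>) \<in> It" by auto
    with BigAnd that(3)[of True i j \<psi>] show ?thesis by (simp add: itn_def)
  next
    case (BigOr i a b \<psi>)
    with inv obtain j where "b = bnd j" "k \<le> j" "j \<le> Suc k" "a = cst \<alpha>" "(False, i, \<psi>) \<in> It" by auto
    with BigOr that(3)[of False i j \<psi>] show ?thesis by (simp add: itn_def)
  qed (use that(1) in auto)
qed

text \<open>
  On an infinite branch every constraint is met by arbitrarily large values, so upper bounds
  on the parameter cannot occur.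
\<close>

lemma arith_up_closed:
  assumes "iter_at t k" "\<chi> \<in> arith_part (L t)"
  shows "x \<le> y \<Longrightarrow> holds (\<lambda>_. x) \<chi> \<Longrightarrow> holds (\<lambda>_. y) \<chi>"
    and "int (Suc k) + 2 * C < x \<Longrightarrow> holds (\<lambda>_. x) \<chi>"
proof -
  from assms(2) have \<chi>: "\<chi> \<in> L t" "is_arith \<chi>" by (auto simp: arith_part_def)
  have inv: "inv k (Suc k) \<chi>" using iter_inv_at[OF assms(1)] \<chi>(1) by blast
  have unb: "\<exists>x\<ge>z. holds (\<lambda>_. x) \<chi>" for z
    using sols_unbounded[OF assms(1), of z] assms(2) by (auto simp: sols_def)
  have H: "0 \<le> int (Suc k) + 2 * C" using C_nonneg by simp
  consider (true) "\<forall>x. holds (\<lambda>_. x) \<chi>" | (false) "\<forall>x. \<not> holds (\<lambda>_. x) \<chi>"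
    | (less) a b where "\<chi> = Less a b" | (geq) a b where "\<chi> = Neg (Less a b)"
    using assms(1) \<chi>(1)
  proof (cases rule: saturated_L)
    case 1
    then show ?thesis using \<chi>(2) that by (cases \<chi>) auto
  next
    case (2 \<chi>')
    then show ?thesis using \<chi>(2) that by (cases \<chi>') auto
  next
    case (3 c i j \<psi>)
    then show ?thesis using \<chi>(2) by (simp add: itn_def split: if_splits)
  qed
  then have "(x \<le> y \<longrightarrow> holds (\<lambda>_. x) \<chi> \<longrightarrow> holds (\<lambda>_. y) \<chi>) \<and>
    (int (Suc k) + 2 * C < x \<longrightarrow> holds (\<lambda>_. x) \<chi>)"
  proof cases
    case (less a b)
    have eq: "holds (\<lambda>_. x) \<chi> \<longleftrightarrow> fst a - fst b < (coef b n - coef a n) * x" for x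
      using inv by (simp add: less leval_single[of a n] leval_single[of b n] algebra_simps)
    have w: "fst a - fst b \<le> int (Suc k) + 2 * C" using inv unfolding less inv.simps by linarith
    show ?thesis
      using linear_up_closed[OF unb[unfolded eq]] w H unfolding eq by blast
  next
    case (geq a b)
    \<comment> \<open>Over the integers b \<le> a reads b - 1 < a, which brings the constraint into
      the strict form handled by \<open>linear_up_closed\<close>.\<close>
    have eq: "holds (\<lambda>_. x) \<chi> \<longleftrightarrow> fst b - fst a - 1 < (coef a n - coef b n) * x" for x
      using inv by (simp add: geq leval_single[of a n] leval_single[of b n] algebra_simps) linarith
    have w: "fst b - fst a - 1 \<le> int (Suc k) + 2 * C" using inv unfolding geq inv.simps by linarith
    show ?thesis
      using linear_up_closed[OF unb[unfolded eq]] w H unfolding eq by blast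
  qed (use unb in auto)
  then show "x \<le> y \<Longrightarrow> holds (\<lambda>_. x) \<chi> \<Longrightarrow> holds (\<lambda>_. y) \<chi>"
    and "int (Suc k) + 2 * C < x \<Longrightarrow> holds (\<lambda>_. x) \<chi>" by blast+
qed

definition threshold :: "nat \<Rightarrow> nat" where
  "threshold t = (LEAST m. int m \<in> sols t)"

text \<open>Upward closed constraints have a ray as solution set. All of them hold beyond k + 1 +
  2C, so the ray starts at k + 2C + 2 or earlier.\<close>

lemma threshold:
  assumes "iter_at t k"
  shows "sols t = {int (threshold t)..}"
    and "int (threshold t) \<le> int k + 2 * C + 2"
proof -
  have big: "int (nat (int k + 2 * C + 2)) \<in> sols t"
    using C_nonneg arith_up_closed(2)[OF assms] by (simp add: sols_def)
  then have m: "int (threshold t) \<in> sols t"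
    unfolding threshold_def by (rule LeastI)
  have least: "threshold t \<le> m" if "int m \<in> sols t" for m
    using that unfolding threshold_def by (rule Least_le)
  show "sols t = {int (threshold t)..}"
  proof (intro set_eqI iffI)
    fix x assume x: "x \<in> sols t"
    then have "0 \<le> x" by (simp add: sols_def)
    with x least[of "nat x"] show "x \<in> {int (threshold t)..}" by simp
  next
    fix x assume "x \<in> {int (threshold t)..}"
    with m arith_up_closed(1)[OF assms, of _ "int (threshold t)" x]
    show "x \<in> sols t" by (auto simp: sols_def)
  qed
  show "int (threshold t) \<le> int k + 2 * C + 2"
    using least[OF big] C_nonneg by linarith
qed

end

section \<open>Pure literals and blocking\<close>

context regular_branch
begin

lemma inv_lit: "inv lo hi (lit s p a) \<longleftrightarrow> inv lo hi (Prop p a)"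
  by (simp add: lit_def)

text \<open>Closure keeps its premises, and the premises of the other rules are not
  literals.\<close>

lemma lit_persist:
  assumes "lit s p a \<in> L t" "t \<le> t'"
  shows "lit s p a \<in> L t'"
  using assms(2)
proof (induction t' rule: dec_induct)
  case (step t')
  obtain K where "inv_at K (Suc K) t'" using ex_inv_at by blast
  then show ?case
  proof (cases rule: step_cases_inv)
    case (Iter k)
    then obtain c i \<psi> \<Psi> where *: "L (Suc t') = \<Psi> \<union> (L t' - {itn c i k \<psi>})"
      by (rule iter_atE)
    with step.IH show ?thesis by (simp add: lit_def itn_def)
  qed (use step.IH in \<open>auto simp: lit_def\<close>)
qed (rule assms(1))

text \<open>Saturation under closure means that the inequality occurs, up to equivalence, somewhere
  on the branch. Its node may be an earlier one, but every current solution also solves that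
  label.\<close>

lemma closure_excludes:
  assumes "iter_at t k" "Prop p a \<in> L t" "Neg (Prop p b) \<in> L t" "v n \<in> sols t"
  shows "leval v a \<noteq> leval v b"
proof -
  have inv: "inv k (Suc k) (Prop p a)" "inv k (Suc k) (Prop p b)"
    using iter_inv_at[OF assms(1)] assms(2,3) by force+
  have "ST_saturated (\<Union>s\<le>t. L s) (L t)"
    using assms(1) by (simp add: iter_at_def)
  moreover have "{Prop p a, Neg (Prop p b)} \<subseteq> L t"
    using assms(2,3) by simp
  ultimately have "\<not> rule (\<Union>s\<le>t. L s) RClosure {Prop p a, Neg (Prop p b)} [{Prop p a, Neg (Prop p b), Neq a b}]"
    unfolding ST_saturated_def by (metis insertCI)
  then have "\<exists>\<chi>\<in>(\<Union>s\<le>t. L s). same_schema \<chi> (Neq a b)"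
    by (rule contrapos_np) (rule rule_closure)
  then obtain s \<chi> where s: "s \<le> t" "\<chi> \<in> L s" "same_schema \<chi> (Neq a b)"
    by blast
  let ?w = "\<lambda>_. v n"
  have "v n \<in> sols s" using assms(4) sols_antimono[OF s(1)] by blast
  moreover have "is_arith \<chi>" and eq: "holds ?w \<chi> \<longleftrightarrow> holds ?w (Neq a b)"
    using same_schema_arith[OF s(3)] assms(4) by (auto simp: sols_def)
  ultimately have "holds ?w (Neq a b)"
    using s(2) by (simp add: sols_def arith_part_def)
  then show ?thesis
    using inv_fst(1)[OF inv(1)] inv_fst(1)[OF inv(2)] by (auto simp: leval_single)
qed

lemma n_not_bound: "n \<notin> set_bound_vars (L t)"
proof
  assume "n \<in> set_bound_vars (L t)"
  then obtain \<chi> X a b \<psi> where *: "\<chi> \<in> L t" "X \<in> iterations \<chi>" "iteration_over X n a b \<psi>"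
    by (auto simp: set_bound_vars_def bound_vars_def)
  obtain K where "inv K (Suc K) \<chi>" using ex_inv_at[of t] *(1) by blast
  from iterations_inv[OF this *(2)] obtain c i k \<psi>' where "X = itn c i k \<psi>'" "(c, i, \<psi>') \<in> It"
    by blast
  then show False using *(3) It[of c i \<psi>'] by (simp add: iteration_over_itn)
qed

text \<open>Unfolds the interval constraints: a bound variable ranges between \<alpha> and the upper
  bound of its iteration.\<close>

lemma excludedI:
  assumes "iter_at t k"
    and "\<And>v. v n \<in> sols t \<Longrightarrow>
      (\<And>c i j \<psi>. itn c i j \<psi> \<in> L t \<Longrightarrow> \<alpha> \<le> v i \<and> v i \<le> v n - \<beta> - int j) \<Longrightarrow>
      leval v a \<noteq> leval v b"
  shows "excluded_equality (L t) a b"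
  unfolding excluded_equality_def arith_sat_def
proof (rule notI, elim exE conjE)
  fix v
  assume pos: "\<forall>x\<in>set_free_vars (L t). 0 \<le> v x"
    and sat: "\<forall>\<chi>\<in>arith_part (L t) \<union> IC (L t) \<union> {Equ a b}. holds v \<chi>"
  have "v n \<in> sols t"
    using pos sat n_free[OF assms(1)] by (simp add: sols_iff_sat)
  moreover have "\<alpha> \<le> v i \<and> v i \<le> v n - \<beta> - int j" if "itn c i j \<psi> \<in> L t" for c i j \<psi>
  proof -
    have X: "itn c i j \<psi> \<in> set_iterations (L t)"
      using that itn_iterations unfolding set_iterations_def by blast
    have over: "iteration_over (itn c i j \<psi>) i (cst \<alpha>) (bnd j) \<psi>"
      by (simp add: iteration_over_itn)
    have "i \<in> set_bound_vars (L t)"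
      using X over unfolding set_iterations_def set_bound_vars_def bound_vars_def by blast
    \<comment> \<open>The bounds involve only \<open>n\<close>, which is free and hence its own
      minimum and maximum; the bounds are therefore their own extrema.\<close>
    moreover have "var_min_max (L t) i (lmin var var (cst \<alpha>)) (lmax var var (bnd j))"
      using X over
    proof (rule var_min_max.bound)
      fix y assume "y \<in> lvars (cst \<alpha>) \<union> lvars (bnd j)"
      then have "y = n" by (auto simp: lvars_eq split: if_splits)
      then show "var_min_max (L t) y (var y) (var y)"
        using n_not_bound by (auto intro: var_min_max.free)
    qed
    ultimately have "And (Leq (lmin var var (cst \<alpha>)) (var i)) (Leq (var i) (lmax var var (bnd j))) \<in> IC (L t)"
      unfolding IC_def by blast
    then have "holds v (And (Leq (lmin var var (cst \<alpha>)) (var i)) (Leq (var i) (lmax var var (bnd j))))"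
      using sat by blast
    moreover have "leval v (lmin var var e) = leval v e" "leval v (lmax var var e) = leval v e" for e
      by (simp_all add: lmin_def lmax_def leval_def[of v e])
    ultimately show ?thesis by simp
  qed
  ultimately have "leval v a \<noteq> leval v b" by (rule assms(2))
  with sat show False by simp
qed

text \<open>Here \<open>x\<close> is the value of the parameter and \<open>y\<close> that of a bound
  variable, so y + \<gamma> lies between \<alpha> + \<gamma> and x - k + C. For c = 1 the offset
  \<open>d\<close> exceeds this range. For c \<ge> 2 the left side is at least 2x - C, which is
  above it. For c \<le> -1 it is at most C - x, which is below it because x > 3C.\<close>

lemma coefficient_bound:
  fixes x y c d \<gamma> j k :: int
  assumes "0 \<le> x" "\<alpha> + \<beta> + k \<le> x + 1" "4 * C + 1 < k" "\<alpha> \<le> y" "y \<le> x - \<beta> - j" "k \<le> j"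
    and "\<bar>\<gamma>\<bar> \<le> C - \<bar>\<beta>\<bar>" "c \<noteq> 0" "c = 1 \<Longrightarrow> C < d + k" "c \<noteq> 1 \<Longrightarrow> \<bar>d\<bar> \<le> C"
  shows "c * x + d \<noteq> y + \<gamma>"
proof
  assume eq: "c * x + d = y + \<gamma>"
  consider "c = 1" | "2 \<le> c" | "c \<le> -1" using assms(8) by linarith
  then show False
  proof cases
    case 1
    then have "x + d = y + \<gamma>" "C < d + k" using eq assms(9) by simp_all
    then show ?thesis using assms(5,6,7) by linarith
  next
    case 2
    then have "2 * x \<le> c * x" using assms(1) by (intro mult_right_mono) auto
    moreover have "\<bar>d\<bar> \<le> C" using assms(10) 2 by simp
    ultimately show ?thesis using eq assms(1,3,5,6,7) C by linarith
  next
    case 3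
    then have "c * x \<le> -1 * x" using assms(1) by (intro mult_right_mono) auto
    moreover have "\<bar>d\<bar> \<le> C" using assms(10) 3 by simp
    ultimately show ?thesis using eq assms(2,3,4,7) C by linarith
  qed
qed

text \<open>Complementary literals of the label itself are separated by closure, and those inside
  the remaining iterations by \<open>coefficient_bound\<close>.\<close>

lemma pure_outside_window:
  assumes t: "iter_at t k" and k: "4 * C + 1 < int k" and l: "lit s p a \<in> L t"
    and c: "coef a n \<noteq> 0" and window: "coef a n = 1 \<Longrightarrow> C < fst a + int k"
  shows "pure_literal (L t) (lit s p a)"
proof -
  have inv: "inv k (Suc k) (Prop p a)"
    using iter_inv_at[OF t] l inv_lit by blast
  have lv: "lvars a \<subseteq> {n}" using inv_fst(1)[OF inv] .
  \<comment> \<open>Unrolling produces only arguments with coefficient 1, so any other argument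
    comes from the original schema.\<close>
  have d: "\<bar>fst a\<bar> \<le> C" if "coef a n \<noteq> 1"
    using inv that As[of a] by auto
  have excl: "excluded_equality (L t) a b" if \<phi>: "\<phi> \<in> L t" and b: "lit (\<not> s) p b \<in> literals \<phi>" for \<phi> b
  proof (rule excludedI[OF t])
    fix v
    assume v: "v n \<in> sols t"
      and IC: "\<And>c i j \<psi>. itn c i j \<psi> \<in> L t \<Longrightarrow> \<alpha> \<le> v i \<and> v i \<le> v n - \<beta> - int j"
    have "lit (\<not> s) p b \<in> L t \<Longrightarrow> leval v a \<noteq> leval v b"
      using closure_excludes[OF t, of p a b v] closure_excludes[OF t, of p b a v] l v
      by (cases s) (auto simp: lit_def)
    moreover have "lit (\<not> s) p b \<in> L t" if "is_atom \<phi>"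
      using that \<phi> b by (cases \<phi>) (auto simp: lit_def)
    moreover have "lit (\<not> s) p b \<in> L t" if "\<phi> = Neg \<chi>" "is_atom \<chi>" for \<chi>
      using that \<phi> b by (cases \<chi>) (auto simp: lit_def)
    moreover have "leval v a \<noteq> leval v b"
      if X: "\<phi> = itn c i j \<psi>" "(c, i, \<psi>) \<in> It" "k \<le> j" for c i j \<psi>
    proof -
      have "Prop p b \<in> literals \<psi> \<or> Neg (Prop p b) \<in> literals \<psi>"
        using b X(1) by (auto simp: lit_def itn_def split: if_splits)
      with It[OF X(2)] obtain \<gamma> where \<gamma>: "b = var i + cst \<gamma>" "\<bar>\<gamma>\<bar> \<le> C - \<bar>\<beta>\<bar>"
        using literals_body by blast
      have bd: "\<alpha> \<le> v i" "v i \<le> v n - \<beta> - int j" using IC \<phi> X(1) by auto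
      have "0 \<le> v n" "\<alpha> + \<beta> + int k \<le> v n + 1"
        using v sols_lower_iter[OF t v] k C_nonneg by (auto simp: sols_def)
      from coefficient_bound[OF this k bd _ \<gamma>(2) c window d] X(3)
      have "coef a n * v n + fst a \<noteq> v i + \<gamma>" by simp
      then show ?thesis using lv by (simp add: leval_single \<gamma>(1))
    qed
    ultimately show "leval v a \<noteq> leval v b"
      using saturated_L[OF t \<phi>] by metis
  qed
  then show ?thesis unfolding pure_literal_def by (cases s) (auto simp: lit_def)
qed

text \<open>
  Everything that matters at an unrolling of index \<open>k\<close>, expressed relatively to \<open>k\<close>:
  the iterations, the literals that need not be pure, and the lower bound on the parameter.
\<close>

definition state :: "nat \<Rightarrow> nat \<Rightarrow>
    ((bool \<times> nat \<times> schema) \<times> nat) set \<times> (bool \<times> nat \<times> int) set \<times> int" where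
  "state t k =
     ({(z, e). z \<in> It \<and> e \<le> 1 \<and> (case z of (c, i, \<psi>) \<Rightarrow> itn c i (k + e) \<psi> \<in> L t)},
      {(s, p, e). p \<in> Ps \<and> - C - 1 \<le> e \<and> e \<le> C \<and> lit s p (var n + cst (e - int k)) \<in> L t},
      int (threshold t) - int k)"

text \<open>The first two components are subsets of finite sets. The relative threshold is bounded
  below by the constraint from the previous unrolling, available since k > 0, and above by
  \<open>threshold\<close>.\<close>

lemma finite_states: "finite {state t k | t k. iter_at t k \<and> 0 < k}"
proof (rule finite_subset)
  show "{state t k | t k. iter_at t k \<and> 0 < k} \<subseteq>
    Pow (It \<times> {..1}) \<times> Pow (UNIV \<times> Ps \<times> {- C - 1..C}) \<times> {- C - 1..2 * C + 2}"
  proof clarify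
    fix A B e t k
    assume st: "(A, B, e) = state t k" and t: "iter_at t k" and k: "0 < k"
    have "int (threshold t) \<in> sols t" using threshold(1)[OF t] by simp
    from sols_lower_iter[OF t this k] threshold(2)[OF t]
    have "- C - 1 \<le> e" "e \<le> 2 * C + 2" using st C by (auto simp: state_def)
    then show "A \<in> Pow (It \<times> {..1}) \<and> (B, e) \<in> Pow (UNIV \<times> Ps \<times> {- C - 1..C}) \<times> {- C - 1..2 * C + 2}"
      using st by (auto simp: state_def)
  qed
  show "finite (Pow (It \<times> {..1::nat}) \<times> Pow ((UNIV :: bool set) \<times> Ps \<times> {- C - 1..C}) \<times> {- C - 1..2 * C + 2})"
    using finite_It finite_Ps by simp
qed

text \<open>Shifting \<open>n\<close> down by k' - k carries the earlier configuration to the later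
  one: constraints, iterations and window literals correspond by equality of states, constant
  literals have persisted, and the others are pure.\<close>

lemma equal_states_subsume:
  assumes t: "iter_at t k" and t': "iter_at t' k'" and k: "k < k'" "4 * C + 1 < int k"
    and st: "state t k = state t' k'"
  shows "L t' \<supseteq>\<^sub>s L t"
proof -
  have "t \<le> t'" using iter_mono[OF t' t] k(1) by force
  define \<iota> where "\<iota> = (\<lambda>x. if x = n then k' - k else 0)"
  let ?V = "set_free_vars (L t') \<union> set_free_vars (L t)"
  have "is_shift ?V \<iota>"
    using n_free[OF t'] k(1) by (auto simp: is_shift_def \<iota>_def)
  moreover have "is_arith \<psi> \<and> arith_entails ?V (arith_part (L t')) (shift \<iota> \<psi>) \<or>
      is_literal \<psi> \<and> pure_literal (L t) \<psi> \<or> (\<exists>\<phi>\<in>L t'. same_schema \<phi> (shift \<iota> \<psi>))"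
    if \<psi>: "\<psi> \<in> L t" for \<psi>
  proof -
    consider (arith) "is_arith \<psi>" | (lit) s p a where "\<psi> = lit s p a"
      | (itn) c i j \<xi> where "\<psi> = itn c i j \<xi>" "(c, i, \<xi>) \<in> It" "k \<le> j" "j \<le> Suc k"
      using t \<psi>
    proof (cases rule: saturated_L)
      case 1
      then show ?thesis
        using that(1) that(2)[of True] by (cases \<psi>) (auto simp: lit_def)
    next
      case (2 \<chi>')
      then show ?thesis
        using that(1) that(2)[of False] by (cases \<chi>') (auto simp: lit_def)
    next
      case (3 c i j \<xi>)
      then show ?thesis by (rule that(3))
    qed
    then show ?thesis
    proof cases
      case arith
      have "arith_entails ?V (arith_part (L t')) (shift \<iota> \<psi>)"
        unfolding arith_entails_def
      proof (intro allI impI, elim conjE)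
        fix v assume "\<forall>x\<in>?V. 0 \<le> v x" "\<forall>\<chi>\<in>arith_part (L t'). holds v \<chi>"
        then have "v n \<in> sols t'"
          using n_free[OF t'] by (simp add: sols_iff_sat)
        then have "int (threshold t') \<le> v n" using threshold(1)[OF t'] by simp
        \<comment> \<open>Equal relative thresholds: the two rays differ exactly by the
          shift.\<close>
        moreover have "int (threshold t) - int k = int (threshold t') - int k'"
          using st by (simp add: state_def)
        ultimately have "int (threshold t) \<le> v n - int (k' - k)" using k(1) by linarith
        then have "v n - int (k' - k) \<in> sols t" using threshold(1)[OF t] by simp
        then have "holds (\<lambda>_. v n - int (k' - k)) \<psi>"
          using \<psi> arith by (simp add: sols_def arith_part_def)
        then have "holds (\<lambda>x. v x - int (\<iota> x)) \<psi>"
          using holds_L[OF \<psi>, of "\<lambda>x. v x - int (\<iota> x)"] by (simp add: \<iota>_def)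
        then show "holds v (shift \<iota> \<psi>)" by (simp add: shift_def holds_subst)
      qed
      with arith show ?thesis by blast
    next
      case (lit s p a)
      have inv: "inv k (Suc k) (Prop p a)"
        using iter_inv_at[OF t] \<psi> lit inv_lit by blast
      have lv: "lvars a \<subseteq> {n}" using inv_fst(1)[OF inv] .
      have coef0: "coef a x = 0" if "x \<noteq> n" for x using lv that by (auto simp: lvars_eq)
      have shift: "shift \<iota> \<psi> = lit s p (lsubst (\<lambda>x. var x - cst (int (\<iota> x))) a)"
        by (simp add: lit lit_def shift_def)
      have is_lit: "is_literal \<psi>" by (simp add: lit lit_def is_literal_def)
      show ?thesis
      proof (cases "coef a n = 0")
        case True
        then have "lsubst (\<lambda>x. var x - cst (int (\<iota> x))) a = a"
          using lv by (auto intro!: lexp_eq_leval simp: leval_single)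
        then have "shift \<iota> \<psi> \<in> L t'"
          using shift lit \<psi> lit_persist[OF _ \<open>t \<le> t'\<close>] by simp
        then show ?thesis using same_schema_refl by blast
      next
        case c: False
        show ?thesis
        proof (cases "coef a n = 1 \<and> fst a + int k \<le> C")
          case True
          then have a: "a = var n + cst (fst a)"
            using coef0 by (intro lexp_eqI) auto
          \<comment> \<open>The window has no further lower side to treat: at index \<open>k\<close>
            no constant lies below -(k + 1 + C).\<close>
          have "- C - 1 \<le> fst a + int k"
            using inv_fst(2)[OF inv] by simp
          then have "(s, p, fst a + int k) \<in> fst (snd (state t k))"
            using True inv \<psi> lit a by (simp add: state_def)
          then have "lit s p (var n + cst (fst a + int k - int k')) \<in> L t'"
            unfolding st by (simp add: state_def)
          moreover have "lsubst (\<lambda>x. var x - cst (int (\<iota> x))) a = var n + cst (fst a + int k - int k')"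
            using k(1) True lv by (auto intro!: lexp_eq_leval simp: leval_single \<iota>_def)
          ultimately show ?thesis using shift same_schema_refl by metis
        next
          case False
          then have "pure_literal (L t) \<psi>"
            unfolding lit using \<psi> lit c by (intro pure_outside_window[OF t k(2)]) auto
          with is_lit show ?thesis by blast
        qed
      qed
    next
      case (itn c i j \<xi>)
      define e where "e = j - k"
      have e: "j = k + e" "e \<le> 1" using itn by (auto simp: e_def)
      have "((c, i, \<xi>), e) \<in> fst (state t k)"
        using itn \<psi> e by (simp add: state_def)
      then have L: "itn c i (k' + e) \<xi> \<in> L t'"
        unfolding st by (simp add: state_def)
      have b: "lsubst (\<lambda>x. var x - cst (int (\<iota> x))) (bnd j) = bnd (k' + e)"
        "lsubst (\<lambda>x. var x - cst (int (\<iota> x))) (cst \<alpha>) = cst \<alpha>"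
        using k(1) e(1) by (auto intro!: lexp_eq_leval simp: \<iota>_def leval_single)
      have "iteration_body Ps (C - \<bar>\<beta>\<bar>) i \<xi>" using It itn(2) by blast
      then have "shift \<iota> \<psi> = itn c i (k' + e) \<xi>"
        using subst_body b by (auto simp: itn(1) itn_def shift_def)
      with L show ?thesis using same_schema_refl by metis
    qed
  qed
  ultimately show ?thesis unfolding subsumes_shifted_def by blast
qed

text \<open>Pigeonhole: infinitely many indices are unrolled but only finitely many states exist.
  Two indices with the same state yield an ancestor that blocks the later label.\<close>

lemma no_ST_branch: False
proof -
  define Ks where "Ks = {k. 4 * C + 1 < int k \<and> (\<exists>t. iter_at t k)}"
  have "infinite Ks"
  proof
    assume "finite Ks"
    then obtain m where m: "\<forall>k\<in>Ks. k \<le> m" unfolding finite_nat_set_iff_bounded_le ..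
    obtain t k where "iter_at t k" "max m (nat (4 * C + 1)) < k"
      using iter_index_unbounded by blast
    then have "k \<in> Ks" "m < k" unfolding Ks_def by auto
    with m show False by (meson not_le)
  qed
  define T where "T k = (SOME t. iter_at t k)" for k
  have T: "iter_at (T k) k" if "k \<in> Ks" for k
    using that unfolding Ks_def T_def by (auto intro: someI_ex)
  have pos: "0 < k" if "k \<in> Ks" for k
    using that C_nonneg by (auto simp: Ks_def intro: gr0I)
  have "(\<lambda>k. state (T k) k) ` Ks \<subseteq> {state t k | t k. iter_at t k \<and> 0 < k}"
    using T pos by blast
  then have "finite ((\<lambda>k. state (T k) k) ` Ks)"
    using finite_states by (rule finite_subset)
  from pigeonhole_infinite[OF \<open>infinite Ks\<close> this] obtain k
    where k: "k \<in> Ks" "infinite {k' \<in> Ks. state (T k') k' = state (T k) k}" by blast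
  then have "\<not> (\<forall>k'\<in>{k' \<in> Ks. state (T k') k' = state (T k) k}. k' \<le> k)"
    unfolding finite_nat_set_iff_bounded_le by blast
  then obtain k' where k': "k < k'" "k' \<in> Ks" "state (T k') k' = state (T k) k"
    by (auto simp: not_le)
  have "L (T k') \<supseteq>\<^sub>s L (T k)"
    using k(1) k' T by (intro equal_states_subsume) (auto simp: Ks_def)
  moreover have "T k \<le> T k'"
    using iter_mono[OF T[OF k'(2)] T[OF k(1)]] k'(1) by force
  ultimately show False
    using ST_branch unfolding ST_branch_def by blast
qed

end

section \<open>From regular schemata to the frame\<close>

lemma regular_body:
  assumes "iterations \<psi> = {}" "\<forall>A\<in>atoms \<psi>. \<exists>p \<gamma>. A = Prop p (var i + cst \<gamma>)"
    and "\<forall>p \<gamma>. Prop p (var i + cst \<gamma>) \<in> subschemata \<psi> \<longrightarrow> p \<in> Ps \<and> \<bar>\<gamma>\<bar> \<le> G"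
    and "is_nnf \<psi>"
  shows "iteration_body Ps G i \<psi>"
  using assms
proof (induction \<psi>)
  case (Prop p a)
  then show ?case by auto
next
  case (Neg \<psi>)
  then show ?case by (auto simp: is_nnf_def)
next
  case (And \<psi> \<chi>)
  then show ?case by (auto simp: is_nnf_def)
next
  case (Or \<psi> \<chi>)
  then show ?case by (auto simp: is_nnf_def)
qed auto

lemma regular_frame_of_regular:
  assumes "regular \<phi>"
  obtains n \<alpha> \<beta> C It Ps As where "regular_frame n \<alpha> \<beta> C It Ps As"
    "regular_frame.inv n \<alpha> \<beta> C It Ps As 0 0 \<phi>"
proof -
  from assms obtain n \<alpha> \<beta> where sch: "is_schema \<phi>" and fv: "free_vars \<phi> = {n}"
    and body: "\<And>X i a b \<psi>. X \<in> iterations \<phi> \<Longrightarrow> iteration_over X i a b \<psi> \<Longrightarrow>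
      iterations \<psi> = {} \<and> (\<forall>A\<in>atoms \<psi>. \<exists>p \<gamma>. A = Prop p (var i + cst \<gamma>))"
    and bounds: "\<And>X. X \<in> iterations \<phi> \<Longrightarrow> \<exists>i \<psi>. iteration_over X i (cst \<alpha>) (var n - cst \<beta>) \<psi>"
    unfolding regular_def by metis
  have disj: "n \<notin> bound_vars \<phi>" and nnf: "is_nnf \<phi>"
    using sch fv by (auto simp: is_schema_def)
  \<comment> \<open>All iterations have the same bounds, so kind, variable and body determine an
    iteration; injectivity of \<open>h\<close> makes \<open>It\<close> finite.\<close>
  define h where "h = (\<lambda>(c, i, \<psi>). (if c then BigAnd else BigOr) i (cst \<alpha>) (var n - cst \<beta>) \<psi>)"
  define It where "It = h -` iterations \<phi>"
  define Ps where "Ps = {p. \<exists>a. Prop p a \<in> subschemata \<phi>}"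
  \<comment> \<open>The restriction on variables leaves out the arguments inside iteration bodies,
    which contain the bound variable.\<close>
  define As where "As = {a. (\<exists>p. Prop p a \<in> subschemata \<phi>) \<and> lvars a \<subseteq> {n}}"
  \<comment> \<open>The sum of all these magnitudes, with those of \<alpha> and \<beta>, is a crude
    common bound on the constants that occur.\<close>
  define g where "g \<chi> = (case \<chi> of Prop p a \<Rightarrow> \<bar>fst a\<bar> | Less a b \<Rightarrow> \<bar>fst a - fst b\<bar> | _ \<Rightarrow> 0)" for \<chi>
  define C where "C = (\<Sum>\<chi>\<in>subschemata \<phi>. g \<chi>) + \<bar>\<alpha>\<bar> + \<bar>\<beta>\<bar>"
  have g: "g \<chi> \<le> C - \<bar>\<alpha>\<bar> - \<bar>\<beta>\<bar>" if "\<chi> \<in> subschemata \<phi>" for \<chi>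
    using member_le_sum[OF that _ finite_subschemata, of g]
    by (auto simp: C_def g_def split: schema.splits)
  have gP: "\<bar>fst a\<bar> \<le> C - \<bar>\<alpha>\<bar> - \<bar>\<beta>\<bar>" if "Prop p a \<in> subschemata \<phi>" for p a
    using g[OF that] by (simp add: g_def)
  have gL: "\<bar>fst a - fst b\<bar> \<le> C - \<bar>\<alpha>\<bar> - \<bar>\<beta>\<bar>" if "Less a b \<in> subschemata \<phi>" for a b
    using g[OF that] by (simp add: g_def)
  have "0 \<le> (\<Sum>\<chi>\<in>subschemata \<phi>. g \<chi>)"
    by (rule sum_nonneg) (auto simp: g_def split: schema.splits)
  then have C: "\<bar>\<alpha>\<bar> + \<bar>\<beta>\<bar> \<le> C" by (simp add: C_def)
  have frame: "regular_frame n \<alpha> \<beta> C It Ps As"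
  proof
    have "finite (iterations \<phi>)"
      using finite_subschemata by (simp add: iterations_def)
    moreover have "inj h" by (auto simp: inj_def h_def split: if_splits)
    ultimately show "finite It" unfolding It_def by (rule finite_vimageI)
    have "Ps \<subseteq> (\<lambda>\<chi>. case \<chi> of Prop p a \<Rightarrow> p | _ \<Rightarrow> 0) ` subschemata \<phi>"
      unfolding Ps_def by force
    then show "finite Ps" using finite_subschemata finite_subset by blast
    have "As \<subseteq> (\<lambda>\<chi>. case \<chi> of Prop p a \<Rightarrow> a | _ \<Rightarrow> 0) ` subschemata \<phi>"
      unfolding As_def by force
    then show "finite As" using finite_subschemata finite_subset by blast
    show "i \<noteq> n \<and> iteration_body Ps (C - \<bar>\<beta>\<bar>) i \<psi>" if "(c, i, \<psi>) \<in> It" for c i \<psi>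
    proof -
      define X where "X = h (c, i, \<psi>)"
      have X: "X \<in> iterations \<phi>" "iteration_over X i (cst \<alpha>) (var n - cst \<beta>) \<psi>"
        using that by (auto simp: It_def X_def h_def iteration_over_def)
      then have "i \<in> bound_vars \<phi>" unfolding bound_vars_def by blast
      then have "i \<noteq> n" using disj by blast
      have "X \<in> subschemata \<phi>" using X(1) by (simp add: iterations_def)
      moreover have "\<psi> \<in> subschemata X" by (simp add: X_def h_def)
      ultimately have sub: "\<chi> \<in> subschemata \<phi>" if "\<chi> \<in> subschemata \<psi>" for \<chi>
        using that subschemata_trans by blast
      have "iteration_body Ps (C - \<bar>\<beta>\<bar>) i \<psi>"
      proof (rule regular_body)
        show "iterations \<psi> = {}" "\<forall>A\<in>atoms \<psi>. \<exists>p \<gamma>. A = Prop p (var i + cst \<gamma>)"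
          using body[OF X] by auto
        show "is_nnf \<psi>" using nnf sub by (auto simp: is_nnf_def)
        show "\<forall>p \<gamma>. Prop p (var i + cst \<gamma>) \<in> subschemata \<psi> \<longrightarrow> p \<in> Ps \<and> \<bar>\<gamma>\<bar> \<le> C - \<bar>\<beta>\<bar>"
        proof (intro allI impI)
          fix p \<gamma> assume "Prop p (var i + cst \<gamma>) \<in> subschemata \<psi>"
          then have "Prop p (var i + cst \<gamma>) \<in> subschemata \<phi>" by (rule sub)
          moreover from this have "p \<in> Ps" unfolding Ps_def by blast
          ultimately show "p \<in> Ps \<and> \<bar>\<gamma>\<bar> \<le> C - \<bar>\<beta>\<bar>" using gP by fastforce
        qed
      qed
      with \<open>i \<noteq> n\<close> show ?thesis by blast
    qed
    show "lvars a \<subseteq> {n} \<and> \<bar>fst a\<bar> \<le> C" if "a \<in> As" for a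
    proof -
      from that obtain p where "Prop p a \<in> subschemata \<phi>" "lvars a \<subseteq> {n}" by (auto simp: As_def)
      with gP[OF this(1)] show ?thesis by simp
    qed
    show "\<bar>\<alpha>\<bar> + \<bar>\<beta>\<bar> \<le> C" by (rule C)
  qed
  interpret regular_frame n \<alpha> \<beta> C It Ps As by (rule frame)
  have bnd0: "var n - cst \<beta> = bnd 0" by (simp add: bnd_def)
  \<comment> \<open>Induction over the subschemata outside bodies: an iteration is recognised
    through \<open>It\<close> without entering its body, where the bound variable would break the
    condition on free variables.\<close>
  have "inv 0 0 \<chi>" if "\<chi> \<in> subschemata \<phi>" "free_vars \<chi> \<subseteq> {n}" for \<chi>
    using that
  proof (induction \<chi>)
    case (Less a b)
    then show ?case using gL[of a b] C by auto
  next
    case (Prop p a)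
    then have "Prop p a \<in> subschemata \<phi>" "lvars a \<subseteq> {n}" by simp_all
    then have "p \<in> Ps" "a \<in> As" unfolding Ps_def As_def by blast+
    then show ?case by simp
  next
    case (Neg \<chi>)
    then have "is_atom \<chi>" "\<chi> \<in> subschemata \<phi>"
      using nnf subschemata_trans[of \<chi> "Neg \<chi>" \<phi>] by (auto simp: is_nnf_def)
    with Neg show ?case by simp
  next
    case (And \<chi> \<xi>)
    then have "\<chi> \<in> subschemata \<phi>" "\<xi> \<in> subschemata \<phi>"
      using subschemata_trans[of _ "And \<chi> \<xi>" \<phi>] by auto
    with And show ?case by simp
  next
    case (Or \<chi> \<xi>)
    then have "\<chi> \<in> subschemata \<phi>" "\<xi> \<in> subschemata \<phi>"
      using subschemata_trans[of _ "Or \<chi> \<xi>" \<phi>] by auto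
    with Or show ?case by simp
  next
    case (BigAnd i a b \<chi>)
    then have X: "BigAnd i a b \<chi> \<in> iterations \<phi>" by (auto simp: iterations_def iteration_over_def)
    from bounds[OF X] have ab: "a = cst \<alpha>" "b = var n - cst \<beta>" by (auto simp: iteration_over_def)
    have "(True, i, \<chi>) \<in> It" using X by (simp add: It_def h_def ab)
    then show ?case by (simp add: ab bnd0)
  next
    case (BigOr i a b \<chi>)
    then have X: "BigOr i a b \<chi> \<in> iterations \<phi>" by (auto simp: iterations_def iteration_over_def)
    from bounds[OF X] have ab: "a = cst \<alpha>" "b = var n - cst \<beta>" by (auto simp: iteration_over_def)
    have "(False, i, \<chi>) \<in> It" using X by (simp add: It_def h_def ab)
    then show ?case by (simp add: ab bnd0)
  qed simp_all
  then have "inv 0 0 \<phi>" using fv by simp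
  with frame show ?thesis by (rule that)
qed

theorem theorem5p21:
  fixes \<phi> :: schema
  assumes "regular \<phi>"
  shows "\<not> (\<exists>D. ST_infinite_derivation D \<phi>)"
proof
  assume "\<exists>D. ST_infinite_derivation D \<phi>"
  then obtain D where "ST_infinite_derivation D \<phi>" ..
  then obtain L where L: "L 0 = {\<phi>}" "ST_branch L"
    by (rule ST_infinite_derivation_branch)
  obtain n \<alpha> \<beta> C It Ps As where frame: "regular_frame n \<alpha> \<beta> C It Ps As"
    and inv: "regular_frame.inv n \<alpha> \<beta> C It Ps As 0 0 \<phi>"
    using assms by (rule regular_frame_of_regular)
  have "regular_branch n \<alpha> \<beta> C It Ps As L"
    by (intro regular_branch.intro regular_branch_axioms.intro) (use frame L inv in auto)
  then show False by (rule regular_branch.no_ST_branch)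
qed

end
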